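(* There exists a map $f \in \mathcal{D} \cap C^\infty(\mathbb{S}^1)$ such that its unique fixed point $p$ is a Sisyphus Attractor, i.e. $|f'(p)|>1$ and $|B_{\delta_p}|>0$.
   Context: $\mathbb{S}^1=\mathbb{R}/\mathbb{Z}$ is the circle and $|\cdot|$ applied to sets denotes Lebesgue measure on $\mathbb{S}^1$ (total mass $1$). $\mathcal{D}$ is the set of local homeomorphisms $f:\mathbb{S}^1\to\mathbb{S}^1$ that are topologically conjugate to the doubling map $x\mapsto 2x \bmod 1$; each such $f$ has a unique fixed point, denoted $p$. $f\in C^\infty(\mathbb{S}^1)$ means that $f$ is infinitely differentiable as a map of the circle (its inverse branches need not be differentiable; critical points are allowed). For a Borel probability measure $\mu$ on $\mathbb{S}^1$, its basin is $B_\mu=\{x\in\mathbb{S}^1 : \frac1n\sum_{i=0}^{n-1}\delta_{f^i(x)}\to\mu \text{ weakly as } n\to\infty\}$. $\delta_p$ is the Dirac measure at $p$. The fixed point $p$ is called a Sisyphus Attractor if $|f'(p)|>1$ and $|B_{\delta_p}|>0$. *)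

theory Defs
  imports "HOL-Probability.Probability"
begin

quotient_type circle = real / "\<lambda>x y :: real. x - y \<in> \<int>"
  morphisms circle_rep to_circle
proof (intro equivpI reflpI sympI transpI)
  fix x y z :: real
  show "x - x \<in> \<int>" by simp
  show "y - x \<in> \<int>" if "x - y \<in> \<int>"
    using Ints_minus[OF that] by simp
  show "x - z \<in> \<int>" if "x - y \<in> \<int>" "y - z \<in> \<int>"
    using Ints_add[OF that] by simp
qed

lemma to_circle_eq_iff: "to_circle x = to_circle y \<longleftrightarrow> x - y \<in> \<int>"
  by (rule circle.abs_eq_iff)

lemma to_circle_surj: "\<exists>t. x = to_circle t"
  by (metis Quotient_abs_rep[OF Quotient_circle])

instantiation circle :: topological_space
begin

definition open_circle :: "circle set \<Rightarrow> bool"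
  where "open_circle U \<longleftrightarrow> open (to_circle -` U)"

instance
  by standard (auto simp: open_circle_def vimage_Int vimage_Union)

end

lemma continuous_to_circle: "continuous_on UNIV to_circle"
  by (simp add: continuous_on_open_vimage open_circle_def)

definition circle_lebesgue :: "circle measure"
  where "circle_lebesgue = distr (restrict_space lborel {0..<1}) borel to_circle"

lemma prob_space_circle_lebesgue: "prob_space circle_lebesgue"
proof -
  have "to_circle \<in> borel_measurable (restrict_space lborel {0..<1})"
    using borel_measurable_continuous_onI[OF continuous_to_circle]
    by (intro measurable_restrict_space1) simp
  moreover have "prob_space (restrict_space lborel {0..<1::real})"
    by (intro prob_spaceI) (simp add: space_restrict_space emeasure_restrict_space)
  ultimately show ?thesis
    unfolding circle_lebesgue_def by (rule prob_space.prob_space_distr[rotated])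
qed

definition is_lift :: "(real \<Rightarrow> real) \<Rightarrow> (circle \<Rightarrow> circle) \<Rightarrow> bool"
  where "is_lift F f \<longleftrightarrow> continuous_on UNIV F \<and> (\<forall>t. f (to_circle t) = to_circle (F t))"

text \<open>
  Two continuous lifts of the same map differ by an integer constant, so the derivative below
  depends neither on the lift nor on the representative of the point, see \<open>circle_deriv_eq\<close>.
\<close>

definition circle_deriv :: "(circle \<Rightarrow> circle) \<Rightarrow> circle \<Rightarrow> real"
  where "circle_deriv f x =
    (THE D. \<exists>F t. is_lift F f \<and> x = to_circle t \<and> (F has_real_derivative D) (at t))"

definition circle_smooth :: "(circle \<Rightarrow> circle) \<Rightarrow> bool"
  where "circle_smooth f \<longleftrightarrow>
    (\<exists>F. is_lift F f \<and> (\<forall>n t. (deriv ^^ n) F field_differentiable (at t)))"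

lemma continuous_Ints_constant:
  fixes g :: "real \<Rightarrow> real"
  assumes "continuous_on UNIV g" "\<And>t. g t \<in> \<int>"
  shows "\<exists>c. \<forall>t. g t = c"
proof -
  have "g constant_on UNIV"
  proof (rule continuous_discrete_range_constant[OF _ assms(1)])
    show "\<exists>e>0. \<forall>y. y \<in> UNIV \<and> g y \<noteq> g x \<longrightarrow> e \<le> norm (g y - g x)" for x
      using Ints_nonzero_abs_ge1[OF Ints_diff[OF assms(2) assms(2)]]
      by (intro exI[of _ 1]) auto
  qed simp
  then show ?thesis by (auto simp: constant_on_def)
qed

lemma circle_deriv_eq:
  assumes F: "is_lift F f" and D: "(F has_real_derivative D) (at t)"
  shows "circle_deriv f (to_circle t) = D"
  unfolding circle_deriv_def
proof (rule the_equality)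
  show "\<exists>F s. is_lift F f \<and> to_circle t = to_circle s \<and> (F has_real_derivative D) (at s)"
    using assms by blast
next
  fix E assume "\<exists>G s. is_lift G f \<and> to_circle t = to_circle s \<and> (G has_real_derivative E) (at s)"
  then obtain G s where G: "is_lift G f" and ts: "to_circle t = to_circle s"
    and E: "(G has_real_derivative E) (at s)" by blast
  define m where "m = s - t"
  have m: "m \<in> \<int>"
    using ts unfolding m_def by (metis to_circle_eq_iff)
  have eq: "to_circle (G (u + m)) = to_circle (F u)" for u
  proof -
    have "to_circle (u + m) = to_circle u" using m by (simp add: to_circle_eq_iff)
    then show ?thesis using F G unfolding is_lift_def by metis
  qed
  have "continuous_on UNIV (\<lambda>u. G (u + m) - F u)"
    using F G unfolding is_lift_def
    by (auto intro!: continuous_intros intro: continuous_on_compose2[of UNIV G])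
  moreover have "G (u + m) - F u \<in> \<int>" for u
    using eq[of u] by (simp add: to_circle_eq_iff)
  ultimately obtain c where c: "G (u + m) - F u = c" for u
    using continuous_Ints_constant by blast
  have "((\<lambda>u. G (u + m)) has_real_derivative E) (at t)"
    using E unfolding m_def by (subst DERIV_shift[symmetric]) (simp add: add.commute)
  moreover have "((\<lambda>u. F u + c) has_real_derivative D) (at t)"
    using D by (auto intro!: derivative_eq_intros)
  moreover have "(\<lambda>u. G (u + m)) = (\<lambda>u. F u + c)"
    using c by (auto simp: algebra_simps)
  ultimately show "E = D" by (metis DERIV_unique)
qed

lift_definition doubling :: "circle \<Rightarrow> circle" is "\<lambda>x. 2 * x"
  by (metis Ints_mult Ints_numeral right_diff_distrib)

definition local_homeomorphism :: "('a::topological_space \<Rightarrow> 'b::topological_space) \<Rightarrow> bool"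
  where "local_homeomorphism f \<longleftrightarrow>
    (\<forall>x. \<exists>U. open U \<and> x \<in> U \<and> open (f ` U) \<and> (\<exists>g. homeomorphism U (f ` U) f g))"

definition top_conjugate :: "('a::topological_space \<Rightarrow> 'a) \<Rightarrow> ('b::topological_space \<Rightarrow> 'b) \<Rightarrow> bool"
  where "top_conjugate f g \<longleftrightarrow>
    (\<exists>h k. homeomorphism UNIV UNIV h k \<and> h \<circ> f = g \<circ> h)"

definition doubling_class :: "(circle \<Rightarrow> circle) set"
  where "doubling_class = {f. local_homeomorphism f \<and> top_conjugate f doubling}"

definition empirical_measure :: "(circle \<Rightarrow> circle) \<Rightarrow> circle \<Rightarrow> nat \<Rightarrow> circle measure"
  where "empirical_measure f x n =
    distr (uniform_count_measure {..<n}) borel (\<lambda>i. (f ^^ i) x)"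

lemma integral_empirical_measure:
  fixes g :: "circle \<Rightarrow> real"
  assumes "continuous_on UNIV g"
  shows "integral\<^sup>L (empirical_measure f x n) g = (\<Sum>i<n. g ((f ^^ i) x)) / real n"
proof -
  have "g \<in> borel_measurable borel"
    using assms by (rule borel_measurable_continuous_onI)
  then have "integral\<^sup>L (empirical_measure f x n) g
      = integral\<^sup>L (uniform_count_measure {..<n}) (\<lambda>i. g ((f ^^ i) x))"
    unfolding empirical_measure_def
    by (intro integral_distr) (auto simp: uniform_count_measure_def measurable_point_measure_eq1)
  also have "\<dots> = (\<Sum>i<n. g ((f ^^ i) x)) / real n"
    unfolding uniform_count_measure_def
    by (subst lebesgue_integral_point_measure_finite) (auto simp: sum_divide_distrib)
  finally show ?thesis .
qed

text \<open>Every continuous test function is bounded, since the circle is compact.\<close>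

definition circle_weak_conv :: "(nat \<Rightarrow> circle measure) \<Rightarrow> circle measure \<Rightarrow> bool"
  where "circle_weak_conv M \<mu> \<longleftrightarrow>
    (\<forall>g :: circle \<Rightarrow> real. continuous_on UNIV g \<longrightarrow>
      (\<lambda>n. integral\<^sup>L (M n) g) \<longlonglongrightarrow> integral\<^sup>L \<mu> g)"

definition basin :: "(circle \<Rightarrow> circle) \<Rightarrow> circle measure \<Rightarrow> circle set"
  where "basin f \<mu> = {x. circle_weak_conv (empirical_measure f x) \<mu>}"

text \<open>
  For continuous \<open>f\<close> every basin is a Borel set, so the Borel restriction of Lebesgue measure
  in \<open>circle_lebesgue\<close> suffices here; the Dirac measure at \<open>p\<close> is \<open>return borel p\<close>.
\<close>

definition sisyphus_attractor :: "(circle \<Rightarrow> circle) \<Rightarrow> circle \<Rightarrow> bool"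
  where "sisyphus_attractor f p \<longleftrightarrow>
    f p = p \<and> \<bar>circle_deriv f p\<bar> > 1 \<and>
    measure circle_lebesgue (basin f (return borel p)) > 0"

end

theory Submission
  imports Defs "HOL-Real_Asymp.Real_Asymp"
begin

text \<open>
  The example is a map whose fixed point \<open>p\<close> is expanding, but whose second preimage \<open>c\<close> of \<open>p\<close> is an
  infinitely flat critical point. Orbits are pushed away from \<open>p\<close> exponentially fast. However, whenever an
  orbit passes at distance \<open>\<delta>\<close> from \<open>c\<close>, it lands within about \<open>exp (- \<kappa> / \<delta>\<^sup>2)\<close> of \<open>p\<close> and then needs
  at least of the order of \<open>1 / \<delta>\<^sup>2\<close> steps to escape. The duration of such an excursion has infinite mean with respect to
  Lebesgue measure, hence the proportion of time spent away from \<open>p\<close> tends to zero for almost every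
  point that starts near \<open>c\<close>.

  Concretely, \<open>p\<close> is the class of \<open>0\<close>, \<open>c\<close> is the class of \<open>1/2\<close>, and the lift \<open>F\<close> has derivative
  proportional to \<open>exp (- 1 / (cos (pi t))\<^sup>2)\<close> (\<open>flat_lift_exists\<close>).

  One geometric property of \<open>F\<close> carries both halves of the proof. Since \<open>F'\<close> is log-concave on \<open>{0..1/2}\<close>,
  \<open>F\<close> expands cross-ratios there (\<open>cross_ratio_expandingI\<close>), so inverse branches contract them.
  As the critical value is \<open>p\<close> itself, the inverse branches of all iterates are defined on the complete arc
  between two lifts of \<open>p\<close> (\<open>contracting_embedding_funpow_G\<close>), and the contraction of cross-ratios controls
  their shape on the middle part of that arc uniformly in the number of iterates.

  For the conjugacy, let \<open>H\<close> be the limit of \<open>F\<^sup>n / 2\<^sup>n\<close>, which is continuous, monotone, and satisfies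
  \<open>H (F t) = 2 H t\<close>. Only integers have integer \<open>H\<close>-values (\<open>H_int\<close>), so the value of
  \<open>H\<close> on an interval of constancy is not dyadic, and such an interval returns infinitely often to the
  middle part of an arc. Pulling back, the contraction of cross-ratios forces room next to it on which \<open>H\<close> is still constant
  (\<open>plateau_extends_left\<close>); repeating this is absurd. So \<open>H\<close> is a homeomorphism.

  For the basin, consider the distance to \<open>p\<close>, on which the dynamics acts as a tent-like map of \<open>{0..1/2}\<close>.
  Contraction of cross-ratios gives every return to \<open>{a..1/2}\<close> a probability at least \<open>c / sqrt M\<close> of taking
  more than \<open>M\<close> steps, whatever the earlier returns were (\<open>measure_quick_image\<close>, \<open>heavy_tail\<close>). Having at
  least \<open>\<epsilon> n\<close> visits to \<open>{a..1/2}\<close> before time \<open>n\<close> requires about \<open>\<epsilon> n\<close> returns in a row shorter than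
  \<open>n\<close>; by Borel--Cantelli this almost surely stops happening (\<open>AE_visits_sublinear\<close>). Finally, the
  distances along the orbit sum up to at most the number of visits plus a constant
  (\<open>orbit_sum_le_visits\<close>), so their averages tend to zero.
\<close>

section \<open>Smooth functions that are flat at the half-integers\<close>

text \<open>
  The factor \<open>1 / x ^ k\<close> makes the family closed under differentiation up to linear combinations; the
  value \<open>0\<close> at the origin is the limit there.
\<close>

definition flat :: "nat \<Rightarrow> real \<Rightarrow> real"
  where "flat k x = (if x = 0 then 0 else exp (- 1 / x\<^sup>2) / x ^ k)"

text \<open>
  Comparing \<open>exp y\<close> with the single term \<open>y ^ Suc k / fact (Suc k)\<close> of its power series, at
  \<open>y = 1 / x\<^sup>2\<close>, beats the denominator \<open>x ^ k\<close> with two powers of \<open>x\<close> to spare. One spare power is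
  enough to differentiate at the origin.
\<close>

lemma flat_bound: "\<bar>flat k x\<bar> \<le> fact (Suc k) * \<bar>x\<bar> ^ (k + 2)"
proof (cases "x = 0")
  case False
  define y where "y = 1 / x\<^sup>2"
  define c :: real where "c = fact (Suc k)"
  have y: "y > 0" and c: "c > 0" using False by (simp_all add: y_def c_def)
  have "y ^ Suc k / c \<le> exp y"
  proof -
    have s: "summable (\<lambda>n. y ^ n /\<^sub>R fact n)" by (rule summable_exp_generic)
    have "(\<Sum>n\<in>{Suc k}. y ^ n /\<^sub>R fact n) \<le> (\<Sum>n. y ^ n /\<^sub>R fact n)"
      by (rule sum_le_suminf[OF s]) (use y in auto)
    then show ?thesis unfolding exp_def c_def by (simp add: divide_inverse mult.commute del: fact_Suc)
  qed
  then have "exp (- y) \<le> c / y ^ Suc k"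
    using y c by (simp add: exp_minus field_simps del: power_Suc)
  also have "\<dots> = c * (\<bar>x\<bar> ^ 2) ^ Suc k"
    by (simp add: y_def power_one_over del: power_Suc)
  also have "\<dots> = c * \<bar>x\<bar> ^ (k + 2) * \<bar>x\<bar> ^ k"
    unfolding mult.assoc power_mult[symmetric] power_add[symmetric] by (simp add: mult_2)
  finally show ?thesis using False
    by (simp add: flat_def y_def c_def abs_divide power_abs pos_divide_le_eq del: fact_Suc)
qed (simp add: flat_def)

lemma flat_has_derivative:
  "(flat k has_real_derivative 2 * flat (k + 3) x - k * flat (k + 1) x) (at x)"
proof (cases "x = 0")
  case True
  define c :: real where "c = fact (Suc (Suc k))"
  have "((\<lambda>h. c * \<bar>h\<bar> ^ (k + 3)) \<longlongrightarrow> c * \<bar>0\<bar> ^ (k + 3)) (at (0::real))"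
    by (intro tendsto_intros)
  then have "(flat (Suc k) \<longlongrightarrow> 0) (at 0)"
    by (intro Lim_null_comparison[of "flat (Suc k)" "\<lambda>h. c * \<bar>h\<bar> ^ (k + 3)"])
       (use flat_bound[of "Suc k", folded c_def] in \<open>auto simp: numeral_3_eq_3\<close>)
  moreover have "flat (Suc k) = (\<lambda>h. flat k h / h)"
    by (auto simp: flat_def fun_eq_iff)
  ultimately show ?thesis
    using True by (simp add: DERIV_def) (simp add: flat_def)
next
  case False
  have "((\<lambda>x. exp (- 1 / x\<^sup>2) / x ^ k) has_real_derivative
      2 * flat (k + 3) x - k * flat (k + 1) x) (at x)"
    using False
    apply (cases k)
    apply (auto intro!: derivative_eq_intros simp: flat_def)
    apply (simp_all add: field_simps power_add eval_nat_numeral)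
    subgoal for n by (cases n) auto
    done
  then show ?thesis
    by (rule has_field_derivative_transform_within_open[where S = "- {0}"])
       (use False in \<open>auto simp: flat_def\<close>)
qed

text \<open>
  Instead of composing general smooth functions, it is enough to have one class of functions that contains
  the density of the map and whose members have derivatives in the class again.
\<close>

inductive flat_trig_poly :: "(real \<Rightarrow> real) \<Rightarrow> bool" where
  const: "flat_trig_poly (\<lambda>t. c)"
| sin: "flat_trig_poly (\<lambda>t. sin (pi * t))"
| cos: "flat_trig_poly (\<lambda>t. cos (pi * t))"
| flat: "flat_trig_poly (\<lambda>t. flat k (cos (pi * t)))"
| add: "flat_trig_poly u \<Longrightarrow> flat_trig_poly v \<Longrightarrow> flat_trig_poly (\<lambda>t. u t + v t)"
| mult: "flat_trig_poly u \<Longrightarrow> flat_trig_poly v \<Longrightarrow> flat_trig_poly (\<lambda>t. u t * v t)"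

lemma flat_trig_poly_derivative:
  assumes "flat_trig_poly u"
  shows "\<exists>u'. flat_trig_poly u' \<and> (\<forall>t. (u has_real_derivative u' t) (at t))"
  using assms
proof induction
  case (const c)
  show ?case by (rule exI[of _ "\<lambda>t. 0"]) (auto intro: flat_trig_poly.intros)
next
  case sin
  show ?case
    by (rule exI[of _ "\<lambda>t. cos (pi * t) * pi"])
       (auto intro!: flat_trig_poly.intros derivative_eq_intros)
next
  case cos
  have "flat_trig_poly (\<lambda>t. sin (pi * t) * (- pi))"
    by (intro flat_trig_poly.intros)
  then show ?case
    by (intro exI[of _ "\<lambda>t. sin (pi * t) * (- pi)"] conjI) (auto intro!: derivative_eq_intros)
next
  case (flat k)
  have "flat_trig_poly (\<lambda>t. (2 * flat (k + 3) (cos (pi * t)) + (- real k) * flat (k + 1) (cos (pi * t)))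
      * (sin (pi * t) * (- pi)))"
    by (intro flat_trig_poly.intros)
  moreover have "((\<lambda>t. flat k (cos (pi * t))) has_real_derivative
      (2 * flat (k + 3) (cos (pi * t)) + (- real k) * flat (k + 1) (cos (pi * t)))
      * (sin (pi * t) * (- pi))) (at t)" for t
    by (rule DERIV_cong[OF DERIV_chain2[OF flat_has_derivative, of "\<lambda>t. cos (pi * t)"]])
       (auto intro!: derivative_eq_intros)
  ultimately show ?case by blast
next
  case (add u v)
  then obtain u' v' where "flat_trig_poly u'" "flat_trig_poly v'"
    "\<And>t. (u has_real_derivative u' t) (at t)" "\<And>t. (v has_real_derivative v' t) (at t)"
    by blast
  then show ?case
    by (intro exI[of _ "\<lambda>t. u' t + v' t"])
       (auto intro!: flat_trig_poly.intros derivative_eq_intros)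
next
  case (mult u v)
  then obtain u' v' where "flat_trig_poly u'" "flat_trig_poly v'"
    "\<And>t. (u has_real_derivative u' t) (at t)" "\<And>t. (v has_real_derivative v' t) (at t)"
    by blast
  with mult.hyps show ?case
    by (intro exI[of _ "\<lambda>t. u' t * v t + v' t * u t"])
       (auto intro!: flat_trig_poly.intros derivative_eq_intros)
qed

lemma flat_trig_poly_deriv: "flat_trig_poly u \<Longrightarrow> flat_trig_poly (deriv u)"
  using flat_trig_poly_derivative by (metis DERIV_imp_deriv ext)

lemma antiderivative_flat_trig_poly_smooth:
  assumes u: "flat_trig_poly u" and F: "\<And>t. (F has_real_derivative u t) (at t)"
  shows "(deriv ^^ n) F field_differentiable (at t)"
proof (cases n)
  case 0
  then show ?thesis using F by (auto simp: field_differentiable_def)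
next
  case (Suc m)
  have "deriv F = u" using F by (auto intro: DERIV_imp_deriv)
  moreover have "flat_trig_poly ((deriv ^^ m) u)"
    by (induction m) (simp_all add: u flat_trig_poly_deriv)
  ultimately show ?thesis
    unfolding Suc funpow_Suc_right o_apply
    using flat_trig_poly_derivative by (auto simp: field_differentiable_def)
qed

section \<open>Cross-ratios and log-concave densities\<close>

text \<open>
  For points \<open>w < x < y < z\<close> the ratio \<open>(z - w) (y - x) / ((x - w) (z - y))\<close> measures how large the middle
  gap is compared with its two neighbours. Written without division, the condition says that \<open>F\<close> does not
  decrease this ratio. For a diffeomorphism this is what a nonpositive Schwarzian derivative yields, but
  unlike a statement about derivatives it survives at critical points and composes without a chain rule.
\<close>

definition cross_ratio_expanding :: "real set \<Rightarrow> (real \<Rightarrow> real) \<Rightarrow> bool" where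
  "cross_ratio_expanding S F \<longleftrightarrow>
    (\<forall>w\<in>S. \<forall>x\<in>S. \<forall>y\<in>S. \<forall>z\<in>S. w < x \<longrightarrow> x < y \<longrightarrow> y < z \<longrightarrow>
      (z - w) * (y - x) * ((F x - F w) * (F z - F y))
      \<le> (F z - F w) * (F y - F x) * ((x - w) * (z - y)))"

text \<open>
  The hypothesis is the infinitesimal form of the conclusion:
  \<open>\<rho> x \<rho> y / (F y - F x)\<^sup>2 \<le> 1 / (y - x)\<^sup>2\<close>. Both sides are mixed second derivatives of
  \<open>ln (F y - F x)\<close> and \<open>ln (y - x)\<close>, so integrating the inequality over \<open>[w, x] \<times> [y, z]\<close> compares the
  logarithms of the two cross-ratios. The double integral is carried out as two monotonicity arguments.
\<close>

lemma cross_ratio_expandingI: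
  fixes F \<rho> :: "real \<Rightarrow> real"
  assumes deriv: "\<And>t. t \<in> {a..b} \<Longrightarrow> (F has_real_derivative \<rho> t) (at t)"
    and mono: "strict_mono_on {a..b} F"
    and ineq: "\<And>x y. a \<le> x \<Longrightarrow> x < y \<Longrightarrow> y \<le> b \<Longrightarrow> \<rho> x * \<rho> y * (y - x)\<^sup>2 \<le> (F y - F x)\<^sup>2"
  shows "cross_ratio_expanding {a..b} F"
  unfolding cross_ratio_expanding_def
proof (intro ballI impI)
  fix w x y z assume S: "w \<in> {a..b}" "x \<in> {a..b}" "y \<in> {a..b}" "z \<in> {a..b}"
    and ord: "w < x" "x < y" "y < z"
  have less: "F u < F v" if "a \<le> u" "u < v" "v \<le> b" for u v
    using mono that by (auto simp: strict_mono_on_def)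
  \<comment> \<open>integration in the first variable, over \<open>{w..x}\<close>\<close>
  have one_variable: "1 / (t - w) - \<rho> t / (F t - F w) \<le> 1 / (t - x) - \<rho> t / (F t - F x)"
    if t: "x < t" "t \<le> b" for t
  proof (rule DERIV_nonneg_imp_nondecreasing[where f = "\<lambda>u. 1 / (t - u) - \<rho> t / (F t - F u)"])
    show "w \<le> x" using ord by simp
    fix u assume u: "w \<le> u" "u \<le> x"
    have ut: "a \<le> u" "u < t" "t \<le> b" using u t S by auto
    have "((\<lambda>u. 1 / (t - u) - \<rho> t / (F t - F u)) has_real_derivative
        1 / (t - u)\<^sup>2 - \<rho> t * \<rho> u / (F t - F u)\<^sup>2) (at u)"
      using less[OF ut] ut
      by (auto intro!: derivative_eq_intros deriv simp: power2_eq_square field_simps)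
    moreover have "0 \<le> 1 / (t - u)\<^sup>2 - \<rho> t * \<rho> u / (F t - F u)\<^sup>2"
      using ineq[OF ut] less[OF ut] ut by (simp add: field_simps)
    ultimately show "\<exists>D. ((\<lambda>u. 1 / (t - u) - \<rho> t / (F t - F u)) has_real_derivative D) (at u) \<and> 0 \<le> D"
      by blast
  qed
  \<comment> \<open>integration in the second variable, over \<open>{y..z}\<close>\<close>
  let ?\<psi> = "\<lambda>t. ln (t - x) - ln (t - w) - (ln (F t - F x) - ln (F t - F w))"
  have "?\<psi> y \<le> ?\<psi> z"
  proof (rule DERIV_nonneg_imp_nondecreasing[where f = ?\<psi>])
    show "y \<le> z" using ord by simp
    fix t assume t: "y \<le> t" "t \<le> z"
    have *: "F x < F t" "F w < F t" "x < t" "w < t" "t \<in> {a..b}"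
      using less[of x t] less[of w t] t S ord by auto
    have "(?\<psi> has_real_derivative
        1 / (t - x) - 1 / (t - w) - (\<rho> t / (F t - F x) - \<rho> t / (F t - F w))) (at t)"
      using * by (auto intro!: derivative_eq_intros deriv simp: divide_inverse)
    moreover have "0 \<le> 1 / (t - x) - 1 / (t - w) - (\<rho> t / (F t - F x) - \<rho> t / (F t - F w))"
      using one_variable[of t] * by auto
    ultimately show "\<exists>D. (?\<psi> has_real_derivative D) (at t) \<and> 0 \<le> D" by blast
  qed
  moreover have pos: "F x < F y" "F w < F y" "F x < F z" "F w < F z" "F w < F x" "F y < F z"
    using less S ord by auto
  ultimately have "ln ((y - x) * (F y - F w) * ((z - w) * (F z - F x)))
      \<le> ln ((z - x) * (F z - F w) * ((y - w) * (F y - F x)))"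
    using ord by (simp add: ln_mult)
  then have "(y - x) * (F y - F w) * ((z - w) * (F z - F x))
      \<le> (z - x) * (F z - F w) * ((y - w) * (F y - F x))"
    using ord pos by (subst (asm) ln_le_cancel_iff) auto
  \<comment> \<open>\<open>(y - w) (z - x) = (y - x) (z - w) + (x - w) (z - y)\<close>, and likewise for the images;
    the common product of the two leading terms cancels\<close>
  then show "(z - w) * (y - x) * ((F x - F w) * (F z - F y))
      \<le> (F z - F w) * (F y - F x) * ((x - w) * (z - y))"
    by (simp add: algebra_simps)
qed

text \<open>
  Log-concavity makes the density at two points that move symmetrically towards each other at least as
  large, in geometric mean, as at the end points. So the average of the density over the interval
  dominates the geometric mean of its end values.
\<close>

lemma sqrt_densities_le_slope:
  fixes F \<rho> :: "real \<Rightarrow> real"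
  assumes deriv: "\<And>t. t \<in> {x..y} \<Longrightarrow> (F has_real_derivative \<rho> t) (at t)"
    and nonneg: "\<And>t. t \<in> {x..y} \<Longrightarrow> \<rho> t \<ge> 0" and "x < y"
    and log_concave: "\<And>s. 0 \<le> s \<Longrightarrow> s \<le> (y - x) / 2 \<Longrightarrow> \<rho> x * \<rho> y \<le> \<rho> (x + s) * \<rho> (y - s)"
  shows "\<rho> x * \<rho> y * (y - x)\<^sup>2 \<le> (F y - F x)\<^sup>2"
proof -
  define g where "g = sqrt (\<rho> x * \<rho> y)"
  have nn: "\<rho> x \<ge> 0" "\<rho> y \<ge> 0" using nonneg \<open>x < y\<close> by auto
  let ?Q = "\<lambda>s. F (x + s) - F (y - s) - 2 * s * g"
  have "?Q 0 \<le> ?Q ((y - x) / 2)"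
  proof (rule DERIV_nonneg_imp_nondecreasing[where f = ?Q])
    show "0 \<le> (y - x) / 2" using \<open>x < y\<close> by simp
    fix s assume s: "0 \<le> s" "s \<le> (y - x) / 2"
    have xs: "x + s \<in> {x..y}" "y - s \<in> {x..y}" using s by (auto simp: field_simps)
    have "g \<le> sqrt (\<rho> (x + s) * \<rho> (y - s))"
      unfolding g_def using log_concave[OF s] by simp
    also have "\<dots> \<le> (\<rho> (x + s) + \<rho> (y - s)) / 2"
      using xs by (intro arith_geo_mean_sqrt nonneg)
    finally have "0 \<le> \<rho> (x + s) * 1 - \<rho> (y - s) * (-1) - 2 * g" by simp
    moreover have "(?Q has_real_derivative \<rho> (x + s) * 1 - \<rho> (y - s) * (-1) - 2 * g) (at s)"
      by (auto intro!: derivative_eq_intros DERIV_chain2[where f = F] deriv xs)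
    ultimately show "\<exists>D. (?Q has_real_derivative D) (at s) \<and> 0 \<le> D" by blast
  qed
  then have "g * (y - x) \<le> F y - F x"
    by (simp add: field_simps)
  moreover have "0 \<le> g * (y - x)" using \<open>x < y\<close> nn by (simp add: g_def)
  ultimately have "(g * (y - x))\<^sup>2 \<le> (F y - F x)\<^sup>2" by (rule power_mono)
  then show ?thesis using nn by (simp add: g_def power_mult_distrib)
qed

lemma inverse_cos_squared_convex:
  fixes x y s :: real
  assumes "0 \<le> x" "y < 1/2" "0 \<le> s" "s \<le> (y - x) / 2"
  shows "1 / (cos (pi * (x + s)))\<^sup>2 + 1 / (cos (pi * (y - s)))\<^sup>2
    \<le> 1 / (cos (pi * x))\<^sup>2 + 1 / (cos (pi * y))\<^sup>2"
proof -
  let ?q = "\<lambda>s. 1 / (cos (pi * (x + s)))\<^sup>2 + 1 / (cos (pi * (y - s)))\<^sup>2"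
  let ?V = "\<lambda>t. 2 * pi * sin (pi * t) / (cos (pi * t)) ^ 3"
  have "?q s \<le> ?q 0"
  proof (rule DERIV_nonpos_imp_nonincreasing[where f = ?q])
    show "0 \<le> s" by fact
    fix r assume r: "0 \<le> r" "r \<le> s"
    have *: "0 \<le> x + r" "x + r \<le> y - r" "y - r < 1/2"
      using assms r by (auto simp: field_simps)
    have b: "0 \<le> pi * (x + r)" "pi * (x + r) \<le> pi * (y - r)" "pi * (y - r) < pi / 2"
      using * mult_strict_left_mono[OF *(3) pi_gt_zero] by (auto intro!: mult_left_mono)
    have c: "cos (pi * (x + r)) > 0" "cos (pi * (y - r)) > 0"
      by (intro cos_gt_zero_pi; use b pi_gt_zero in linarith)+
    have "sin (pi * (x + r)) \<le> sin (pi * (y - r))"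
      by (intro sin_monotone_2pi_le; use b pi_gt_zero in linarith)
    moreover have "0 \<le> sin (pi * (x + r))"
      using b by (intro sin_ge_zero) auto
    moreover have "cos (pi * (y - r)) \<le> cos (pi * (x + r))"
      using b by (intro cos_monotone_0_pi_le) auto
    ultimately have "?V (x + r) \<le> ?V (y - r)"
      using c by (intro frac_le mult_left_mono power_mono) auto
    moreover have "(?q has_real_derivative ?V (x + r) - ?V (y - r)) (at r)"
      using c by (auto intro!: derivative_eq_intros simp: field_simps eval_nat_numeral)
    ultimately show "\<exists>D. (?q has_real_derivative D) (at r) \<and> D \<le> 0"
      by (intro exI[of _ "?V (x + r) - ?V (y - r)"]) simp
  qed
  then show ?thesis by simp
qed

section \<open>A smooth lift that is flat at the second preimage of the fixed point\<close>

text \<open>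
  Everything the dynamics needs from the lift \<open>F\<close> of the circle map. Oddness and \<open>shift\<close> force
  \<open>F (1/2) = 1\<close>, so \<open>1/2\<close> represents the second preimage of the fixed point. The inequality \<open>ge_double\<close>
  gives repulsion at \<open>0\<close>, \<open>flat_at_half\<close> makes points near \<open>1/2\<close> land extremely close to the fixed point,
  and \<open>le_linear\<close> bounds the speed at which they can escape from it afterwards.
\<close>

locale flat_lift =
  fixes F :: "real \<Rightarrow> real" and \<Lambda> K \<kappa> :: real
  assumes continuous: "continuous_on UNIV F"
    and strict_mono: "strict_mono F"
    and odd: "F (- t) = - F t"
    and shift: "F (t + 1) = F t + 2"
    and ge_double: "0 \<le> t \<Longrightarrow> t \<le> 1/2 \<Longrightarrow> 2 * t \<le> F t"
    and le_linear: "0 \<le> t \<Longrightarrow> t \<le> 1/2 \<Longrightarrow> F t \<le> \<Lambda> * t"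
    and flat_at_half: "0 < s \<Longrightarrow> s \<le> 1/2 \<Longrightarrow> 1 - F (1/2 - s) \<le> K * exp (- \<kappa> / s\<^sup>2)"
    and \<kappa>_pos: "\<kappa> > 0"
    and expanding: "cross_ratio_expanding {0..1/2} F"

lemma flat_0_nonneg: "flat 0 x \<ge> 0"
  by (simp add: flat_def)

lemma flat_0_mono: "0 \<le> x \<Longrightarrow> x \<le> y \<Longrightarrow> flat 0 x \<le> flat 0 y"
  by (auto simp: flat_def intro!: divide_left_mono power_mono mult_pos_pos)

lemma strict_mono_if_density_pos_dense:
  fixes F \<rho> :: "real \<Rightarrow> real"
  assumes F: "\<And>t. (F has_real_derivative \<rho> t) (at t)" and nonneg: "\<And>t. \<rho> t \<ge> 0"
    and pos: "\<And>x y. x < y \<Longrightarrow> \<exists>t\<in>{x<..<y}. \<rho> t > 0"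
  shows "strict_mono F"
proof (rule strict_monoI)
  fix x y :: real assume "x < y"
  have mono: "F u \<le> F v" if "u \<le> v" for u v
    using that by (rule DERIV_nonneg_imp_nondecreasing) (use F nonneg in blast)
  obtain t where t: "x < t" "t < y" "\<rho> t > 0" using pos[OF \<open>x < y\<close>] by auto
  show "F x < F y"
  proof (rule ccontr)
    assume "\<not> F x < F y"
    then have eq: "F u = F x" if "u \<in> {x<..<y}" for u
      using mono[of x u] mono[of u y] that by auto
    have "(F has_real_derivative 0) (at t)"
      by (rule has_field_derivative_transform_within_open[where f = "\<lambda>_. F x" and S = "{x<..<y}"])
         (use t eq in auto)
    then show False using DERIV_unique[OF F] t by fastforce
  qed
qed

lemma cos_pi_nonzero_dense:
  assumes "x < (y::real)"
  shows "\<exists>t\<in>{x<..<y}. cos (pi * t) \<noteq> 0"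
proof (rule ccontr)
  assume "\<not> ?thesis"
  then have zero: "cos (pi * u) = 0" if "u \<in> {x<..<y}" for u using that by blast
  define t where "t = (x + y) / 2"
  have t: "t \<in> {x<..<y}" using assms by (auto simp: t_def)
  have "((\<lambda>u. cos (pi * u)) has_real_derivative 0) (at t)"
    by (rule has_field_derivative_transform_within_open[where f = "\<lambda>_. 0" and S = "{x<..<y}"])
       (use t zero in auto)
  moreover have "((\<lambda>u. cos (pi * u)) has_real_derivative - sin (pi * t) * pi) (at t)"
    by (auto intro!: derivative_eq_intros)
  ultimately have "sin (pi * t) = 0" using DERIV_unique by fastforce
  then show False using zero[OF t] sin_cos_squared_add[of "pi * t"] by simp
qed

text \<open>
  The density of \<open>F\<close> is a multiple of \<open>exp (- 1 / (cos (pi t))\<^sup>2)\<close>. It is even and has period one, which makes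
  \<open>F\<close> odd and gives it degree two after normalisation. It decreases on \<open>{0..1/2}\<close>, so \<open>F\<close> is concave
  there and lies above the chord through \<open>(0, 0)\<close> and \<open>(1/2, 1)\<close>. It is log-concave there because
  \<open>1 / cos\<^sup>2\<close> is convex.
\<close>

theorem flat_lift_exists:
  obtains F \<rho> \<Lambda> K \<kappa> where "flat_lift F \<Lambda> K \<kappa>" "flat_trig_poly \<rho>"
    "\<And>t. (F has_real_derivative \<rho> t) (at t)" "\<rho> 0 > 1"
proof -
  let ?\<rho> = "\<lambda>t. flat 0 (cos (pi * t))"
  have "isCont ?\<rho> t" for t
    using flat_trig_poly_derivative[OF flat_trig_poly.flat] DERIV_isCont by blast
  then obtain A where A: "\<And>t. (A has_real_derivative ?\<rho> t) (at t)"
    using einterval_antiderivative[of "-\<infinity>" "\<infinity>" ?\<rho>]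
    by (auto simp: has_real_derivative_iff_has_vector_derivative)
  have "strict_mono A"
  proof (rule strict_mono_if_density_pos_dense[OF A flat_0_nonneg])
    show "\<exists>t\<in>{x<..<y}. ?\<rho> t > 0" if "x < y" for x y
      using cos_pi_nonzero_dense[OF that] by (auto simp: flat_def)
  qed
  then have A01: "A 0 < A 1" by (simp add: strict_mono_def)
  \<comment> \<open>normalises the degree to \<open>2\<close>\<close>
  define c where "c = 2 / (A 1 - A 0)"
  have c: "c > 0" using A01 by (simp add: c_def)
  define F where "F t = c * (A t - A 0)" for t
  define \<rho> where "\<rho> t = c * ?\<rho> t" for t
  have F: "(F has_real_derivative \<rho> t) (at t)" for t
    unfolding F_def \<rho>_def using A by (auto intro!: derivative_eq_intros)
  have F0: "F 0 = 0" by (simp add: F_def)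
  have F1: "F 1 = 2" using A01 by (simp add: F_def c_def divide_eq_eq)
  have mono: "strict_mono F"
    using \<open>strict_mono A\<close> c by (auto simp: F_def strict_mono_def)
  have nonneg: "\<rho> t \<ge> 0" for t using c by (simp add: \<rho>_def flat_0_nonneg)
  have odd: "F (- t) = - F t" for t
  proof -
    have "((\<lambda>t. F t + F (- t)) has_real_derivative \<rho> t + \<rho> (- t) * (- 1)) (at t)" for t
      by (rule DERIV_add[OF F DERIV_chain2[OF F]]) (auto intro!: derivative_eq_intros)
    then have "F t + F (- t) = F 0 + F (- 0)"
      by (intro DERIV_isconst_all) (auto simp: \<rho>_def)
    then show ?thesis by (simp add: F0)
  qed
  have shift: "F (t + 1) = F t + 2" for t
  proof -
    have "cos (pi * (t + 1)) = - cos (pi * t)" for t by (simp add: distrib_left)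
    then have "\<rho> (t + 1) = \<rho> t" for t by (simp add: \<rho>_def flat_def)
    moreover have "((\<lambda>t. F (t + 1) - F t) has_real_derivative \<rho> (t + 1) * 1 - \<rho> t) (at t)" for t
      by (rule DERIV_diff[OF DERIV_chain2[OF F] F]) (auto intro!: derivative_eq_intros)
    ultimately have "F (t + 1) - F t = F (0 + 1) - F 0"
      by (intro DERIV_isconst_all) auto
    then show ?thesis by (simp add: F0 F1)
  qed
  have half: "F (1/2) = 1" using shift[of "-1/2"] odd[of "1/2"] by simp
  have antimono: "\<rho> t \<le> \<rho> s" if "0 \<le> s" "s \<le> t" "t \<le> 1/2" for s t
  proof -
    have st: "0 \<le> pi * s" "pi * s \<le> pi * t" "pi * t \<le> pi / 2"
      using that mult_left_mono[OF that(3), of pi] by auto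
    then have "cos (pi * t) \<le> cos (pi * s)" by (intro cos_monotone_0_pi_le) auto
    moreover have "0 \<le> cos (pi * t)" by (intro cos_ge_zero; use st pi_gt_zero in linarith)
    ultimately show ?thesis using c by (simp add: \<rho>_def flat_0_mono)
  qed
  have mvt: "\<exists>u. s \<le> u \<and> u \<le> t \<and> F t - F s = (t - s) * \<rho> u" if "s \<le> t" for s t
  proof (cases "s = t")
    case False
    then show ?thesis using MVT2[of s t F \<rho>] F that by (meson less_eq_real_def order_le_less)
  qed auto
  have ge_double: "2 * t \<le> F t" if t: "0 \<le> t" "t \<le> 1/2" for t
  proof -
    \<comment> \<open>concavity: the slope over \<open>{0..t}\<close> is at least the slope over \<open>{t..1/2}\<close>\<close>
    obtain u where u: "0 \<le> u" "u \<le> t" "F t - F 0 = (t - 0) * \<rho> u" using mvt[OF t(1)] by auto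
    obtain v where v: "t \<le> v" "v \<le> 1/2" "F (1/2) - F t = (1/2 - t) * \<rho> v" using mvt[OF t(2)] by auto
    have "t * (1 - F t) = t * (1/2 - t) * \<rho> v" using v by (simp add: half)
    also have "\<dots> \<le> t * (1/2 - t) * \<rho> u"
      using t u v by (intro mult_left_mono antimono) auto
    also have "\<dots> = (1/2 - t) * F t" using u by (simp add: F0)
    finally show ?thesis by (simp add: algebra_simps)
  qed
  have le_linear: "F t \<le> \<rho> 0 * t" if t: "0 \<le> t" "t \<le> 1/2" for t
  proof -
    obtain u where u: "0 \<le> u" "u \<le> t" "F t - F 0 = (t - 0) * \<rho> u" using mvt[OF t(1)] by auto
    have "t * \<rho> u \<le> t * \<rho> 0" using t u by (intro mult_left_mono antimono) auto
    then show ?thesis using u by (simp add: F0 mult.commute)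
  qed
  have flat_at_half: "1 - F (1/2 - s) \<le> c * exp (- (1 / pi\<^sup>2) / s\<^sup>2)" if s: "0 < s" "s \<le> 1/2" for s
  proof -
    obtain u where u: "1/2 - s \<le> u" "u \<le> 1/2" "F (1/2) - F (1/2 - s) = (1/2 - (1/2 - s)) * \<rho> u"
      using mvt[of "1/2 - s" "1/2"] s by auto
    have cos_eq: "cos (pi * (1/2 - s)) = sin (pi * s)"
      by (simp add: right_diff_distrib cos_diff)
    have "1 - F (1/2 - s) = s * \<rho> u" using u(3) by (simp add: half)
    also have "\<dots> \<le> 1 * \<rho> (1/2 - s)"
      using s u nonneg by (intro mult_mono antimono) auto
    also have "\<dots> = c * flat 0 (sin (pi * s))"
      unfolding \<rho>_def cos_eq by simp
    also have "\<dots> \<le> c * flat 0 (pi * s)"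
      using c s sin_ge_zero[of "pi * s"] sin_x_le_x[of "pi * s"] mult_left_mono[OF s(2), of pi]
      by (intro mult_left_mono flat_0_mono) (auto simp: field_simps)
    also have "\<dots> = c * exp (- (1 / pi\<^sup>2) / s\<^sup>2)"
      using s by (simp add: flat_def power_mult_distrib)
    finally show ?thesis .
  qed
  have log_concave: "\<rho> x * \<rho> y \<le> \<rho> (x + s) * \<rho> (y - s)"
    if "0 \<le> x" "x < y" "y \<le> 1/2" "0 \<le> s" "s \<le> (y - x) / 2" for x y s
  proof (cases "y = 1/2")
    case True
    have "\<rho> y = 0" unfolding True \<rho>_def by (simp add: flat_def)
    then show ?thesis using nonneg by simp
  next
    case False
    have exp_form: "\<rho> t = c * exp (- (1 / (cos (pi * t))\<^sup>2))" if "0 \<le> t" "t < 1/2" for t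
    proof -
      have "cos (pi * t) > 0"
        by (intro cos_gt_zero_pi; use that mult_strict_left_mono[OF that(2) pi_gt_zero]
          mult_nonneg_nonneg[OF pi_ge_zero that(1)] pi_gt_zero in linarith)
      then show ?thesis by (simp add: \<rho>_def flat_def)
    qed
    have "\<rho> x * \<rho> y = c\<^sup>2 * exp (- (1 / (cos (pi * x))\<^sup>2 + 1 / (cos (pi * y))\<^sup>2))"
      using that False by (simp add: exp_form exp_add exp_diff exp_minus power2_eq_square field_simps)
    also have "\<dots> \<le> c\<^sup>2 * exp (- (1 / (cos (pi * (x + s)))\<^sup>2 + 1 / (cos (pi * (y - s)))\<^sup>2))"
      using inverse_cos_squared_convex[of x y s] that False by (intro mult_left_mono) auto
    also have "\<dots> = \<rho> (x + s) * \<rho> (y - s)"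
    proof -
      have "0 \<le> x + s" "x + s < 1/2" "0 \<le> y - s" "y - s < 1/2"
        using that False by (auto simp: field_simps)
      then show ?thesis
        by (simp add: exp_form exp_add exp_diff exp_minus power2_eq_square field_simps)
    qed
    finally show ?thesis .
  qed
  have "flat_lift F (\<rho> 0) c (1 / pi\<^sup>2)"
  proof
    show "continuous_on UNIV F"
      using F by (meson DERIV_continuous_on has_field_derivative_at_within)
    show "cross_ratio_expanding {0..1/2} F"
    proof (rule cross_ratio_expandingI[OF F])
      show "strict_mono_on {0..1/2} F"
        using mono by (auto simp: strict_mono_on_def strict_mono_def)
      show "\<rho> x * \<rho> y * (y - x)\<^sup>2 \<le> (F y - F x)\<^sup>2" if "0 \<le> x" "x < y" "y \<le> 1/2" for x y
        using that by (intro sqrt_densities_le_slope F nonneg log_concave) auto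
    qed
  qed (use mono odd shift ge_double le_linear flat_at_half in auto)
  moreover have "flat_trig_poly \<rho>"
    unfolding \<rho>_def by (intro flat_trig_poly.intros)
  moreover have "\<rho> 0 > 1"
    using le_linear[of "1/2"] half by simp
  ultimately show thesis using that F by blast
qed

section \<open>Inverse branches contract cross-ratios\<close>

definition cross_ratio_contracting :: "real set \<Rightarrow> (real \<Rightarrow> real) \<Rightarrow> bool" where
  "cross_ratio_contracting S \<Phi> \<longleftrightarrow>
    (\<forall>w\<in>S. \<forall>x\<in>S. \<forall>y\<in>S. \<forall>z\<in>S. w < x \<longrightarrow> x < y \<longrightarrow> y < z \<longrightarrow>
      (\<Phi> z - \<Phi> w) * (\<Phi> y - \<Phi> x) * ((x - w) * (z - y))
      \<le> (z - w) * (y - x) * ((\<Phi> x - \<Phi> w) * (\<Phi> z - \<Phi> y)))"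

text \<open>
  The maps that will describe inverse branches of iterates, parametrised by the whole arc between
  consecutive lifts of the fixed point. Both orientations occur, since reflecting the circle exchanges
  branches.
\<close>

definition contracting_embedding :: "(real \<Rightarrow> real) \<Rightarrow> bool" where
  "contracting_embedding \<Phi> \<longleftrightarrow> continuous_on {0..1} \<Phi> \<and>
    (strict_mono_on {0..1} \<Phi> \<or> strict_antimono_on {0..1} \<Phi>) \<and> cross_ratio_contracting {0..1} \<Phi>"

lemma cross_ratio_contractingD:
  "cross_ratio_contracting S \<Phi> \<Longrightarrow> w \<in> S \<Longrightarrow> x \<in> S \<Longrightarrow> y \<in> S \<Longrightarrow> z \<in> S \<Longrightarrow>
    w < x \<Longrightarrow> x < y \<Longrightarrow> y < z \<Longrightarrow>
    (\<Phi> z - \<Phi> w) * (\<Phi> y - \<Phi> x) * ((x - w) * (z - y))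
      \<le> (z - w) * (y - x) * ((\<Phi> x - \<Phi> w) * (\<Phi> z - \<Phi> y))"
  unfolding cross_ratio_contracting_def by blast

text \<open>
  The change of the cross-ratio under a composition is the product of the changes. An orientation-reversing
  \<open>\<sigma>\<close> reverses the order of the four points, and the condition is symmetric under that reversal.
\<close>

lemma contracting_embedding_compose:
  assumes \<Phi>: "contracting_embedding \<Phi>" and \<sigma>: "contracting_embedding \<sigma>"
    and maps: "\<sigma> ` {0..1} \<subseteq> {0..1}"
  shows "contracting_embedding (\<lambda>t. \<Phi> (\<sigma> t))"
  unfolding contracting_embedding_def
proof (intro conjI)
  show "continuous_on {0..1} (\<lambda>t. \<Phi> (\<sigma> t))"
    using \<Phi> \<sigma> maps unfolding contracting_embedding_def by (auto intro: continuous_on_compose2)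
  have mono: "strict_mono_on {0..1} f \<longleftrightarrow> (\<forall>x\<in>{0..1}. \<forall>y\<in>{0..1}. x < y \<longrightarrow> f x < f y)"
    and antimono: "strict_antimono_on {0..1} f \<longleftrightarrow> (\<forall>x\<in>{0..1}. \<forall>y\<in>{0..1}. x < y \<longrightarrow> f y < f x)"
    for f :: "real \<Rightarrow> real"
    by (auto simp: monotone_on_def)
  have \<sigma>01: "\<sigma> t \<in> {0..1}" if "t \<in> {0..1}" for t using maps that by blast
  have cases: "(\<forall>x\<in>{0..1}. \<forall>y\<in>{0..1}. x < y \<longrightarrow> f x < f y) \<or>
      (\<forall>x\<in>{0..1}. \<forall>y\<in>{0..1}. x < y \<longrightarrow> f y < f x)" if "contracting_embedding f" for f
    using that unfolding contracting_embedding_def mono antimono by blast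
  show "strict_mono_on {0..1} (\<lambda>t. \<Phi> (\<sigma> t)) \<or> strict_antimono_on {0..1} (\<lambda>t. \<Phi> (\<sigma> t))"
    using cases[OF \<Phi>] cases[OF \<sigma>] \<sigma>01 unfolding mono antimono by meson
  show "cross_ratio_contracting {0..1} (\<lambda>t. \<Phi> (\<sigma> t))"
    unfolding cross_ratio_contracting_def
  proof (intro ballI impI)
    fix w x y z :: real
    assume S: "w \<in> {0..1}" "x \<in> {0..1}" "y \<in> {0..1}" "z \<in> {0..1}" and ord: "w < x" "x < y" "y < z"
    let ?N = "(z - w) * (y - x)" and ?D = "(x - w) * (z - y)"
    let ?N' = "(\<sigma> z - \<sigma> w) * (\<sigma> y - \<sigma> x)" and ?D' = "(\<sigma> x - \<sigma> w) * (\<sigma> z - \<sigma> y)"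
    let ?N'' = "(\<Phi> (\<sigma> z) - \<Phi> (\<sigma> w)) * (\<Phi> (\<sigma> y) - \<Phi> (\<sigma> x))"
    let ?D'' = "(\<Phi> (\<sigma> x) - \<Phi> (\<sigma> w)) * (\<Phi> (\<sigma> z) - \<Phi> (\<sigma> y))"
    have 1: "?N' * ?D \<le> ?N * ?D'"
      using \<sigma> S ord unfolding contracting_embedding_def by (intro cross_ratio_contractingD) auto
    have crc: "cross_ratio_contracting {0..1} \<Phi>" using \<Phi> by (simp add: contracting_embedding_def)
    have "?D' > 0 \<and> ?D'' > 0 \<and> ?N'' * ?D' \<le> ?N' * ?D''"
      using cases[OF \<sigma>]
    proof
      assume "\<forall>x\<in>{0..1}. \<forall>y\<in>{0..1}. x < y \<longrightarrow> \<sigma> x < \<sigma> y"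
      then have o: "\<sigma> w < \<sigma> x" "\<sigma> x < \<sigma> y" "\<sigma> y < \<sigma> z" using S ord by blast+
      have "(\<Phi> (\<sigma> w) < \<Phi> (\<sigma> x) \<and> \<Phi> (\<sigma> y) < \<Phi> (\<sigma> z)) \<or> (\<Phi> (\<sigma> x) < \<Phi> (\<sigma> w) \<and> \<Phi> (\<sigma> z) < \<Phi> (\<sigma> y))"
        using cases[OF \<Phi>] o \<sigma>01[OF S(1)] \<sigma>01[OF S(2)] \<sigma>01[OF S(3)] \<sigma>01[OF S(4)] by blast
      then have "?D'' > 0" by (auto simp: zero_less_mult_iff)
      then show ?thesis
        using cross_ratio_contractingD[OF crc \<sigma>01[OF S(1)] \<sigma>01[OF S(2)] \<sigma>01[OF S(3)] \<sigma>01[OF S(4)] o] o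
        by auto
    next
      assume "\<forall>x\<in>{0..1}. \<forall>y\<in>{0..1}. x < y \<longrightarrow> \<sigma> y < \<sigma> x"
      then have o: "\<sigma> z < \<sigma> y" "\<sigma> y < \<sigma> x" "\<sigma> x < \<sigma> w" using S ord by blast+
      have "(\<Phi> (\<sigma> w) < \<Phi> (\<sigma> x) \<and> \<Phi> (\<sigma> y) < \<Phi> (\<sigma> z)) \<or> (\<Phi> (\<sigma> x) < \<Phi> (\<sigma> w) \<and> \<Phi> (\<sigma> z) < \<Phi> (\<sigma> y))"
        using cases[OF \<Phi>] o \<sigma>01[OF S(1)] \<sigma>01[OF S(2)] \<sigma>01[OF S(3)] \<sigma>01[OF S(4)] by blast
      then have "?D'' > 0" by (auto simp: zero_less_mult_iff)
      moreover have "?D' > 0" using o by (simp add: mult_neg_neg)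
      moreover have "?N'' * ?D' \<le> ?N' * ?D''"
        using cross_ratio_contractingD[OF crc \<sigma>01[OF S(4)] \<sigma>01[OF S(3)] \<sigma>01[OF S(2)] \<sigma>01[OF S(1)] o]
        by (simp add: algebra_simps)
      ultimately show ?thesis by blast
    qed
    then have D': "?D' > 0" and D'': "?D'' > 0" and 2: "?N'' * ?D' \<le> ?N' * ?D''" by auto
    have D: "?D > 0" using ord by simp
    have "?N'' * ?D * ?D' = ?N'' * ?D' * ?D" by (simp add: mult_ac)
    also have "\<dots> \<le> ?N' * ?D'' * ?D" using 2 D by (intro mult_right_mono) auto
    also have "\<dots> = ?N' * ?D * ?D''" by (simp add: mult_ac)
    also have "\<dots> \<le> ?N * ?D' * ?D''" using 1 D'' by (intro mult_right_mono) auto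
    also have "\<dots> = ?N * ?D'' * ?D'" by (simp add: mult_ac)
    finally show "?N'' * ?D \<le> ?N * ?D''" using D' by (rule mult_right_le_imp_le)
  qed
qed

lemma contracting_embedding_reflection: "contracting_embedding (\<lambda>t. 1 - t)"
  unfolding contracting_embedding_def cross_ratio_contracting_def
  by (auto intro!: continuous_intros simp: monotone_on_def algebra_simps)

lemma contracting_embedding_translation: "contracting_embedding (\<lambda>t. c + t)"
  unfolding contracting_embedding_def cross_ratio_contracting_def
  by (auto intro!: continuous_intros simp: monotone_on_def algebra_simps)

lemma degree_lift_shift:
  fixes f :: "real \<Rightarrow> real"
  assumes shift: "\<And>t. f (t + 1) = f t + d"
  shows "f (t + of_int m) = f t + of_int m * d"
proof (induction m rule: int_induct[where k = 0])
  case (step1 i)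
  then show ?case using shift[of "t + of_int i"] by (simp add: algebra_simps)
next
  case (step2 i)
  then show ?case using shift[of "t + of_int (i - 1)"] by (simp add: algebra_simps)
qed simp

text \<open>
  Used with \<open>d = 2\<close> for the lift of the circle map and with \<open>d = 1\<close> for the lift of its conjugacy to doubling.
\<close>

lemma degree_lift_homeomorphism:
  fixes f :: "real \<Rightarrow> real"
  assumes cont: "continuous_on UNIV f" and mono: "strict_mono f"
    and shift: "\<And>t. f (t + 1) = f t + d" and d: "d > 0"
  shows "bij f" "strict_mono (inv f)" "continuous_on UNIV (inv f)"
proof -
  have "\<exists>t. f t = y" for y
  proof -
    obtain n :: int where n: "\<bar>y - f 0\<bar> / d \<le> n" by (meson le_of_int_ceiling)
    then have "\<bar>y - f 0\<bar> \<le> of_int n * d" using d by (simp add: pos_divide_le_eq)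
    then have y: "f (- of_int n) \<le> y" "y \<le> f (of_int n)"
      using degree_lift_shift[of f d 0 n, OF shift] degree_lift_shift[of f d 0 "-n", OF shift]
      by (auto simp: abs_le_iff)
    have "(0::real) \<le> \<bar>y - f 0\<bar> / d" using d by simp
    then have "0 \<le> real_of_int n" using n by linarith
    then show ?thesis
      using IVT'[of f "- of_int n" y "of_int n"] y cont by (meson continuous_on_subset le_minus_iff
        neg_le_iff_le order_trans top_greatest neg_le_0_iff_le)
  qed
  then have "surj f" by (metis surjI)
  with mono show bij: "bij f" by (simp add: bij_def strict_mono_imp_inj_on)
  have inv: "f (inv f y) = y" "inv f (f t) = t" for y t
    using bij by (auto simp: bij_def surj_f_inv_f)
  show "strict_mono (inv f)"
    using mono inv by (metis strict_mono_def strict_mono_less)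
  have "isCont (inv f) (f t)" for t
    by (rule isCont_inverse_function2[of "t - 1" t "t + 1" "inv f" f])
       (use cont inv in \<open>auto simp: continuous_on_eq_continuous_at\<close>)
  then have "isCont (inv f) y" for y using inv(1)[of y] by metis
  then show "continuous_on UNIV (inv f)" by (simp add: continuous_on_eq_continuous_at)
qed

context flat_lift
begin

definition G :: "real \<Rightarrow> real" where "G = inv F"

lemma shift_int: "F (t + of_int m) = F t + 2 * of_int m"
  using degree_lift_shift[of F 2 t m, OF shift] by simp

lemma bij: "bij F" and G_strict_mono: "strict_mono G" and G_continuous: "continuous_on UNIV G"
  using degree_lift_homeomorphism[OF continuous strict_mono shift] unfolding G_def by auto

lemma F_G [simp]: "F (G y) = y" and G_F [simp]: "G (F t) = t"
  using bij by (auto simp: G_def bij_def surj_f_inv_f)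

lemma F_less_iff [simp]: "F s < F t \<longleftrightarrow> s < t" and F_le_iff [simp]: "F s \<le> F t \<longleftrightarrow> s \<le> t"
  using strict_mono by (auto simp: strict_mono_less strict_mono_less_eq)

lemma G_less_iff [simp]: "G s < G t \<longleftrightarrow> s < t" and G_le_iff [simp]: "G s \<le> G t \<longleftrightarrow> s \<le> t"
  using G_strict_mono by (auto simp: strict_mono_less strict_mono_less_eq)

lemma F_0 [simp]: "F 0 = 0" using odd[of 0] by simp
lemma F_half [simp]: "F (1/2) = 1" using shift[of "-1/2"] odd[of "1/2"] by simp

lemma G_0 [simp]: "G 0 = 0" using G_F[of 0] by simp
lemma G_1 [simp]: "G 1 = 1/2" using G_F[of "1/2"] by simp

lemma G_shift: "G (y + 2 * of_int m) = G y + of_int m"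
proof -
  have "F (G y + of_int m) = y + 2 * of_int m" by (simp add: shift_int)
  then show ?thesis by (metis G_F)
qed

lemma G_odd: "G (- y) = - G y"
  by (metis F_G G_F odd)

lemma G_bounds: "0 \<le> y \<Longrightarrow> y \<le> 1 \<Longrightarrow> 0 \<le> G y \<and> G y \<le> 1/2"
  by (metis G_0 G_1 G_le_iff)

lemma contracting_embedding_G: "contracting_embedding G"
  unfolding contracting_embedding_def
proof (intro conjI disjI1)
  show "continuous_on {0..1} G" using G_continuous continuous_on_subset by blast
  show "strict_mono_on {0..1} G" by (simp add: strict_mono_on_def)
  show "cross_ratio_contracting {0..1} G"
    unfolding cross_ratio_contracting_def
  proof (intro ballI impI)
    fix w x y z :: real
    assume S: "w \<in> {0..1}" "x \<in> {0..1}" "y \<in> {0..1}" "z \<in> {0..1}" and ord: "w < x" "x < y" "y < z"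
    have "G t \<in> {0..1/2}" if "t \<in> {0..1}" for t using G_bounds that by auto
    then have "(G z - G w) * (G y - G x) * ((F (G x) - F (G w)) * (F (G z) - F (G y)))
      \<le> (F (G z) - F (G w)) * (F (G y) - F (G x)) * ((G x - G w) * (G z - G y))"
      using expanding ord S unfolding cross_ratio_expanding_def by (meson G_less_iff)
    then show "(G z - G w) * (G y - G x) * ((x - w) * (z - y))
      \<le> (z - w) * (y - x) * ((G x - G w) * (G z - G y))" by simp
  qed
qed

lemma contracting_embedding_compose_G:
  assumes "contracting_embedding \<Phi>"
  shows "contracting_embedding (\<lambda>y. \<Phi> (G y))" "contracting_embedding (\<lambda>y. \<Phi> (G (1 - y)))"
proof -
  show 1: "contracting_embedding (\<lambda>y. \<Phi> (G y))"
    by (rule contracting_embedding_compose[OF assms contracting_embedding_G])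
       (use G_bounds in force)
  show "contracting_embedding (\<lambda>y. \<Phi> (G (1 - y)))"
    by (rule contracting_embedding_compose[OF 1 contracting_embedding_reflection]) auto
qed

text \<open>
  The critical value of the circle map is its fixed point. Hence every inverse branch of every iterate is
  defined on the full arc between two consecutive integers, where no critical value is met, and cross-ratio
  contraction holds on the whole arc. This gives space on both sides of the middle part of the arc at all
  times, without any distortion estimate.
\<close>

lemma contracting_embedding_funpow_G: "contracting_embedding (\<lambda>y. (G ^^ n) (of_int m + y))"
proof (induction n arbitrary: m)
  case 0
  then show ?case using contracting_embedding_translation by simp
next
  case (Suc n)
  consider l where "m = 2 * l" | l where "m = 2 * l + 1" by (meson evenE oddE)
  then show ?case
  proof cases
    case 1
    have "(G ^^ Suc n) (of_int m + y) = (G ^^ n) (of_int l + G y)" for y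
      using G_shift[of y l] by (simp add: 1 funpow_swap1 add.commute)
    then show ?thesis using contracting_embedding_compose_G(1)[OF Suc[of l]] by simp
  next
    case 2
    have "(G ^^ Suc n) (of_int m + y) = (G ^^ n) (of_int l + (1 - G (1 - y)))" for y
    proof -
      have "G (of_int m + y) = G (- (1 - y) + 2 * of_int (l + 1))" by (simp add: 2 algebra_simps)
      also have "\<dots> = of_int l + (1 - G (1 - y))"
        unfolding G_shift G_odd by simp
      finally show ?thesis by (simp add: funpow_swap1)
    qed
    moreover have "contracting_embedding (\<lambda>y. (G ^^ n) (of_int l + (1 - y)))"
      by (rule contracting_embedding_compose[OF Suc[of l] contracting_embedding_reflection]) auto
    ultimately show ?thesis using contracting_embedding_compose_G(2) by simp
  qed
qed

end

section \<open>Conjugacy to the doubling map\<close>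

context flat_lift
begin

lemma F_minus_double_bounded: "\<bar>F t - 2 * t\<bar> \<le> 1"
proof -
  have half: "\<bar>F s - 2 * s\<bar> \<le> 1" if "0 \<le> s" "s \<le> 1/2" for s
    using ge_double[OF that] F_le_iff[of s "1/2"] that by auto
  define m where "m = \<lfloor>t + 1/2\<rfloor>"
  define s where "s = t - of_int m"
  have s: "-1/2 \<le> s" "s \<le> 1/2"
    unfolding s_def m_def by linarith+
  have "F t - 2 * t = F s - 2 * s" using shift_int[of s m] by (simp add: s_def)
  also have "\<bar>F s - 2 * s\<bar> \<le> 1"
    using half[of s] half[of "- s"] s odd[of s] by (cases "0 \<le> s") auto
  finally show ?thesis .
qed

text \<open>
  The telescoping form of the limit of \<open>F\<^sup>n t / 2\<^sup>n\<close>. As a series it converges uniformly, since \<open>F\<close> stays at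
  bounded distance from doubling, so its sum is continuous.
\<close>

definition H_term :: "nat \<Rightarrow> real \<Rightarrow> real"
  where "H_term n t = ((F ^^ Suc n) t - 2 * (F ^^ n) t) / 2 ^ Suc n"

definition H :: "real \<Rightarrow> real"
  where "H t = t + (\<Sum>n. H_term n t)"

lemma H_term_bound: "norm (H_term n t) \<le> (1/2) ^ Suc n"
  using F_minus_double_bounded[of "(F ^^ n) t"]
  by (simp add: H_term_def abs_divide power_divide divide_right_mono)

lemma summable_H_bound: "summable (\<lambda>n. (1/2::real) ^ Suc n)"
  using sums_summable[OF power_half_series] by simp

lemma H_term_summable: "summable (\<lambda>n. H_term n t)"
  by (rule summable_comparison_test'[OF summable_H_bound H_term_bound])

lemma H_term_partial_sum: "t + (\<Sum>n<N. H_term n t) = (F ^^ N) t / 2 ^ N"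
  by (induction N) (auto simp: H_term_def field_simps)

lemma H_limit: "(\<lambda>N. (F ^^ N) t / 2 ^ N) \<longlonglongrightarrow> H t"
  unfolding H_term_partial_sum[symmetric] H_def
  by (intro tendsto_intros summable_LIMSEQ H_term_summable)

lemma H_bounded: "\<bar>H t - t\<bar> \<le> 1"
proof -
  have "norm (\<Sum>n. H_term n t) \<le> (\<Sum>n. (1/2) ^ Suc n)"
    by (rule norm_suminf_le[OF H_term_bound summable_H_bound])
  also have "\<dots> = 1" using power_half_series by (simp add: sums_iff)
  finally show ?thesis by (simp add: H_def)
qed

lemma funpow_continuous: "continuous_on UNIV (F ^^ n)"
proof (induction n)
  case (Suc n)
  then show ?case using continuous_on_compose[of UNIV "F ^^ n" F] continuous
    by (auto intro: continuous_on_subset)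
qed (simp add: id_def)

lemma H_continuous: "continuous_on UNIV H"
proof -
  have "continuous_on UNIV (H_term n)" for n
    unfolding H_term_def using funpow_continuous[of n] funpow_continuous[of "Suc n"]
    by (auto intro!: continuous_intros simp del: funpow.simps)
  then have "continuous_on UNIV (\<lambda>t. \<Sum>n. H_term n t)"
    by (intro uniform_limit_theorem[OF _ Weierstrass_m_test[OF H_term_bound summable_H_bound]])
       (auto intro!: continuous_intros always_eventually)
  then show ?thesis unfolding H_def by (intro continuous_intros)
qed

lemma H_F: "H (F t) = 2 * H t"
proof (rule LIMSEQ_unique[OF H_limit])
  have "(\<lambda>N. 2 * ((F ^^ Suc N) t / 2 ^ Suc N)) \<longlonglongrightarrow> 2 * H t"
    by (intro tendsto_intros LIMSEQ_Suc[OF H_limit])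
  then show "(\<lambda>N. (F ^^ N) (F t) / 2 ^ N) \<longlonglongrightarrow> 2 * H t"
    by (simp add: funpow_swap1)
qed

lemma H_funpow: "H ((F ^^ n) t) = 2 ^ n * H t"
  by (induction n) (auto simp: H_F)

lemma funpow_shift: "(F ^^ n) (t + of_int m) = (F ^^ n) t + 2 ^ n * of_int m"
proof (induction n)
  case (Suc n)
  then show ?case using shift_int[of "(F ^^ n) t" "2 ^ n * m"] by simp
qed simp

lemma funpow_odd: "(F ^^ n) (- t) = - (F ^^ n) t"
  by (induction n) (auto simp: odd)

lemma H_shift: "H (t + of_int m) = H t + of_int m"
proof (rule LIMSEQ_unique[OF H_limit])
  have "(\<lambda>N. (F ^^ N) t / 2 ^ N + of_int m) \<longlonglongrightarrow> H t + of_int m"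
    by (intro tendsto_intros H_limit)
  then show "(\<lambda>N. (F ^^ N) (t + of_int m) / 2 ^ N) \<longlonglongrightarrow> H t + of_int m"
    by (simp add: funpow_shift add_divide_distrib)
qed

lemma H_odd: "H (- t) = - H t"
proof (rule LIMSEQ_unique[OF H_limit])
  show "(\<lambda>N. (F ^^ N) (- t) / 2 ^ N) \<longlonglongrightarrow> - H t"
    using tendsto_minus[OF H_limit[of t]] by (simp add: funpow_odd)
qed

lemma H_mono: "s \<le> t \<Longrightarrow> H s \<le> H t"
proof (rule LIMSEQ_le[OF H_limit H_limit])
  assume "s \<le> t"
  then have "(F ^^ N) s \<le> (F ^^ N) t" for N by (induction N) auto
  then show "\<exists>N. \<forall>n\<ge>N. (F ^^ n) s / 2 ^ n \<le> (F ^^ n) t / 2 ^ n"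
    by (simp add: divide_right_mono)
qed

lemma H_0 [simp]: "H 0 = 0" using H_odd[of 0] by simp
lemma H_1 [simp]: "H 1 = 1" using H_shift[of 0 1] by simp
lemma H_half [simp]: "H (1/2) = 1/2" using H_F[of "1/2"] by simp

text \<open>
  A point \<open>t > 0\<close> with \<open>H t = 0\<close> would have its whole orbit in \<open>{0..1/2}\<close>, where \<open>F\<close> at least doubles.
\<close>

lemma H_pos:
  assumes "t > 0" shows "H t > 0"
proof (rule ccontr)
  assume "\<not> H t > 0"
  then have "H t = 0" using H_mono[of 0 t] assms by auto
  then have zero: "H ((F ^^ n) t) = 0" for n by (simp add: H_funpow)
  have le_half: "s \<le> 1/2" if "H s = 0" for s
    using H_mono[of "1/2" s] that by (cases "s \<le> 1/2") auto
  have "2 ^ n * t \<le> (F ^^ n) t" for n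
  proof (induction n)
    case (Suc n)
    have "0 \<le> 2 ^ n * t" using assms by simp
    then have "2 * (F ^^ n) t \<le> F ((F ^^ n) t)"
      using Suc le_half[OF zero[of n]] by (intro ge_double) auto
    then show ?case using Suc by simp
  qed simp
  then have bound: "2 ^ n * t \<le> 1/2" for n using le_half[OF zero[of n]] order_trans by blast
  obtain n where "1 / t < 2 ^ n" using real_arch_pow[of 2 "1 / t"] by auto
  then show False using bound[of n] assms by (simp add: field_simps)
qed

lemma H_int: "H t = of_int m \<Longrightarrow> t = of_int m"
  using H_pos[of "t - of_int m"] H_pos[of "of_int m - t"] H_shift[of t "-m"] H_odd[of "t - of_int m"]
  by (cases t "of_int m :: real" rule: linorder_cases) auto

lemma G_half: "0 < G (1/2)" "G (1/2) < 1/2"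
  using G_less_iff[of 0 "1/2"] G_less_iff[of "1/2" 1] by auto

text \<open>
  The image interval of a plateau of \<open>H\<close> never contains a half-integer, as \<open>H\<close> would then be a dyadic
  rational on it. While the left end is below \<open>G (1/2)\<close> the interval stays in \<open>{0..1/2}\<close> and the left end
  doubles at least. So the left end reaches \<open>G (1/2)\<close>, and the whole interval is then away from the integers.
\<close>

lemma plateau_left_half_returns:
  assumes "0 < \<alpha>" "\<alpha> \<le> \<beta>" and eq: "H \<alpha> = H \<beta>" and lt: "H \<alpha> < 1/2"
    and nonint: "\<And>n m. 2 ^ n * H \<alpha> \<noteq> of_int m"
  shows "\<exists>k. G (1/2) \<le> (F ^^ k) \<alpha> \<and> (F ^^ k) \<beta> \<le> 1/2"
proof -
  have below: "(F ^^ k) t < 1/2" if "(F ^^ k) \<alpha> \<le> 1/2" "H t = H \<alpha>" for k t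
  proof (rule ccontr)
    assume "\<not> ?thesis"
    then have "1/2 \<le> 2 ^ k * H \<alpha>"
      using H_mono[of "1/2" "(F ^^ k) t"] that by (simp add: H_funpow)
    moreover have "2 ^ k * H \<alpha> \<le> 1/2"
      using H_mono[OF that(1)] by (simp add: H_funpow)
    ultimately show False using nonint[of "Suc k" 1] by simp
  qed
  have "\<exists>k. G (1/2) \<le> (F ^^ k) \<alpha>"
  proof (rule ccontr)
    assume "\<nexists>k. G (1/2) \<le> (F ^^ k) \<alpha>"
    then have small: "(F ^^ k) \<alpha> < 1/2" for k using G_half by (metis less_trans not_le)
    have "2 ^ k * \<alpha> \<le> (F ^^ k) \<alpha>" for k
    proof (induction k)
      case (Suc k)
      have "0 \<le> 2 ^ k * \<alpha>" using assms by simp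
      then have "2 * (F ^^ k) \<alpha> \<le> F ((F ^^ k) \<alpha>)"
        using Suc small[of k] by (intro ge_double) auto
      then show ?case using Suc by simp
    qed simp
    then have bound: "2 ^ k * \<alpha> \<le> 1/2" for k using small[of k] by (meson less_imp_le order_trans)
    obtain n where "1 / \<alpha> < 2 ^ n" using real_arch_pow[of 2 "1 / \<alpha>"] by auto
    then show False using bound[of n] assms by (simp add: field_simps)
  qed
  define k where "k = (LEAST k. G (1/2) \<le> (F ^^ k) \<alpha>)"
  have k: "G (1/2) \<le> (F ^^ k) \<alpha>"
    unfolding k_def using \<open>\<exists>k. _\<close> by (rule LeastI_ex)
  have "(F ^^ k) \<alpha> \<le> 1/2"
  proof (cases k)
    case 0
    then show ?thesis using lt H_mono[of "1/2" \<alpha>] by force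
  next
    case (Suc j)
    then have "\<not> G (1/2) \<le> (F ^^ j) \<alpha>" unfolding k_def by (intro not_less_Least) simp
    then have "F ((F ^^ j) \<alpha>) < F (G (1/2))" by (simp del: F_G)
    then show ?thesis by (simp add: Suc)
  qed
  then show ?thesis using k below[of k \<beta>] eq by force
qed

text \<open>
  Integer translation and reflection reduce all cases to a plateau whose \<open>H\<close>-value is in \<open>{0<..<1/2}\<close>.
\<close>

lemma plateau_returns:
  assumes "\<alpha> \<le> \<beta>" and eq: "H \<alpha> = H \<beta>" and nonint: "\<And>n m. 2 ^ n * H \<alpha> \<noteq> of_int m"
  shows "\<exists>k m. of_int m + G (1/2) \<le> (F ^^ k) \<alpha> \<and> (F ^^ k) \<beta> \<le> of_int m + (1 - G (1/2))"
proof -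
  define l where "l = \<lfloor>H \<alpha>\<rfloor>"
  define \<alpha>' where "\<alpha>' = \<alpha> - of_int l"
  define \<beta>' where "\<beta>' = \<beta> - of_int l"
  have H': "H \<alpha>' = H \<alpha> - of_int l" "H \<beta>' = H \<alpha>'"
    using H_shift[of \<alpha> "-l"] H_shift[of \<beta> "-l"] eq by (auto simp: \<alpha>'_def \<beta>'_def)
  have nonint': "2 ^ n * H \<alpha>' \<noteq> of_int m" for n m
    using nonint[of n "m + 2 ^ n * l"] by (auto simp: H' algebra_simps)
  have "0 \<le> H \<alpha>'" "H \<alpha>' < 1" unfolding H' l_def by linarith+
  moreover have "H \<alpha>' \<noteq> 0" using nonint'[of 0 0] by simp
  moreover have "H \<alpha>' \<noteq> 1/2" using nonint'[of 1 1] by simp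
  ultimately have cases: "H \<alpha>' > 0" "H \<alpha>' < 1" "H \<alpha>' < 1/2 \<or> H \<alpha>' > 1/2" by auto
  have pos: "\<alpha>' > 0" using cases(1) H_mono[of \<alpha>' 0] by force
  have lt1: "\<beta>' < 1" using cases(2) H_mono[of 1 \<beta>'] H'(2) by force
  have "\<alpha>' \<le> \<beta>'" using assms by (simp add: \<alpha>'_def \<beta>'_def)
  have "\<exists>k m. of_int m + G (1/2) \<le> (F ^^ k) \<alpha>' \<and> (F ^^ k) \<beta>' \<le> of_int m + (1 - G (1/2))"
    using cases(3)
  proof
    assume "H \<alpha>' < 1/2"
    then obtain k where "G (1/2) \<le> (F ^^ k) \<alpha>'" "(F ^^ k) \<beta>' \<le> 1/2"
      using plateau_left_half_returns[OF pos \<open>\<alpha>' \<le> \<beta>'\<close> H'(2)[symmetric] _ nonint'] by blast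
    then show ?thesis using G_half by (intro exI[of _ k] exI[of _ 0]) auto
  next
    assume "H \<alpha>' > 1/2"
    have H1: "H (1 - t) = 1 - H t" for t using H_shift[of "- t" 1] by (simp add: H_odd)
    have F1: "(F ^^ k) (1 - t) = 2 ^ k - (F ^^ k) t" for k t
      using funpow_shift[of k "- t" 1] by (simp add: funpow_odd)
    have nonint1: "2 ^ n * H (1 - \<beta>') \<noteq> of_int m" for n m
      using nonint'[of n "2 ^ n - m"] by (auto simp: H1 H'(2) algebra_simps)
    obtain k where "G (1/2) \<le> (F ^^ k) (1 - \<beta>')" "(F ^^ k) (1 - \<alpha>') \<le> 1/2"
      using plateau_left_half_returns[of "1 - \<beta>'" "1 - \<alpha>'"] nonint1 \<open>H \<alpha>' > 1/2\<close> lt1 \<open>\<alpha>' \<le> \<beta>'\<close>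
      by (auto simp: H1 H'(2))
    then show ?thesis using G_half by (intro exI[of _ k] exI[of _ "2 ^ k - 1"]) (auto simp: F1)
  qed
  then obtain k m where km: "of_int m + G (1/2) \<le> (F ^^ k) \<alpha>'" "(F ^^ k) \<beta>' \<le> of_int m + (1 - G (1/2))"
    by blast
  have "(F ^^ k) \<alpha> = (F ^^ k) \<alpha>' + 2 ^ k * of_int l" "(F ^^ k) \<beta> = (F ^^ k) \<beta>' + 2 ^ k * of_int l"
    unfolding funpow_shift[symmetric] by (simp_all add: \<alpha>'_def \<beta>'_def)
  then show ?thesis using km by (intro exI[of _ k] exI[of _ "m + 2 ^ k * l"]) auto
qed

lemma G_funpow_F [simp]: "(G ^^ n) ((F ^^ n) t) = t"
  by (induction n) (auto simp: funpow_swap1[of G])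

lemma G_funpow_less: "(G ^^ n) s < (G ^^ n) t \<longleftrightarrow> s < t"
  by (induction n) auto

lemma H_G_funpow: "H ((G ^^ n) t) = H t / 2 ^ n"
proof -
  have "(F ^^ n) ((G ^^ n) t) = t" by (induction n) (auto simp: funpow_swap1[of F])
  then show ?thesis using H_funpow[of n "(G ^^ n) t"] by simp
qed

text \<open>
  Let the plateau return at a late time \<open>N\<close> to the middle part of the arc \<open>{m..m + 1}\<close>. Pulling back by \<open>G\<^sup>N\<close>
  cannot increase the cross-ratio, so the gap between \<open>u\<close> and the pulled back left end \<open>e\<close> of the arc is at
  least a fixed fraction of \<open>v - u\<close>. But \<open>H\<close> varies by at most \<open>1 / 2\<^sup>N\<close> between \<open>e\<close> and \<open>u\<close>. As \<open>N\<close> is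
  arbitrarily large, \<open>H\<close> is constant on a fixed interval to the left of \<open>u\<close>.
\<close>

lemma plateau_extends_left:
  assumes "u < v" and eq: "H u = H v" and nonint: "\<And>n m. 2 ^ n * H u \<noteq> of_int m"
  shows "H (u - (v - u) * (G (1/2))\<^sup>2) = H u"
proof -
  let ?a = "G (1/2)" and ?\<delta> = "(v - u) * (G (1/2))\<^sup>2"
  have "H u - (1/2) ^ n \<le> H (u - ?\<delta>)" for n
  proof -
    have "(F ^^ n) u \<le> (F ^^ n) v" using assms by (induction n) auto
    moreover have "2 ^ j * H ((F ^^ n) u) \<noteq> of_int m" for j m
      using nonint[of "j + n" m] by (simp add: H_funpow power_add)
    moreover have "H ((F ^^ n) u) = H ((F ^^ n) v)" using eq by (simp add: H_funpow)
    ultimately obtain k m where km: "of_int m + ?a \<le> (F ^^ k) ((F ^^ n) u)"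
        "(F ^^ k) ((F ^^ n) v) \<le> of_int m + (1 - ?a)"
      using plateau_returns by blast
    define N where "N = k + n"
    define x where "x = (F ^^ N) u - of_int m"
    define y where "y = (F ^^ N) v - of_int m"
    have "(F ^^ N) u < (F ^^ N) v" using assms by (induction N) auto
    with km have xy: "?a \<le> x" "y \<le> 1 - ?a" "x < y" by (auto simp: x_def y_def N_def funpow_add)
    define e where "e = (G ^^ N) (of_int m)"
    define d where "d = (G ^^ N) (of_int m + 1)"
    have uv: "(G ^^ N) (of_int m + x) = u" "(G ^^ N) (of_int m + y) = v" by (auto simp: x_def y_def)
    have "e < u" "v < d"
      unfolding e_def d_def using xy G_half uv G_funpow_less by (metis less_add_same_cancel1 less_le_trans,
        metis add_less_cancel_left le_less_trans diff_add_cancel less_add_same_cancel1 less_diff_eq add.commute)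
    have "(d - e) * (v - u) * ((x - 0) * (1 - y)) \<le> (1 - 0) * (y - x) * ((u - e) * (d - v))"
      using cross_ratio_contractingD[of "{0..1}" "\<lambda>y. (G ^^ N) (of_int m + y)" 0 x y 1]
        contracting_embedding_funpow_G[of N m] xy G_half
      unfolding contracting_embedding_def uv by (auto simp: e_def d_def)
    also have "\<dots> \<le> 1 * ((u - e) * (d - e))"
      using xy G_half \<open>e < u\<close> \<open>v < d\<close> \<open>u < v\<close> by (intro mult_mono) auto
    finally have "(d - e) * ((v - u) * (x * (1 - y))) \<le> (d - e) * (u - e)"
      by (simp add: mult_ac)
    then have "(v - u) * (x * (1 - y)) \<le> u - e"
      using \<open>e < u\<close> \<open>v < d\<close> \<open>u < v\<close> by (simp add: mult_le_cancel_left)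
    moreover have "?\<delta> \<le> (v - u) * (x * (1 - y))"
      unfolding power2_eq_square using xy G_half \<open>u < v\<close> by (intro mult_left_mono mult_mono) auto
    ultimately have "e \<le> u - ?\<delta>" by simp
    then have "H e \<le> H (u - ?\<delta>)" by (rule H_mono)
    moreover have "H u - (1/2) ^ n \<le> H e"
    proof -
      have "(F ^^ N) u \<le> of_int (m + 1)" using xy G_half by (auto simp: x_def)
      then have "2 ^ N * H u \<le> of_int m + 1" using H_mono H_shift[of 0 "m + 1"] by (fastforce simp: H_funpow)
      then have "H u \<le> (of_int m + 1) / 2 ^ N" by (simp add: pos_le_divide_eq mult.commute)
      then have "H u - (1/2) ^ N \<le> of_int m / 2 ^ N" by (simp add: add_divide_distrib power_one_over)
      moreover have "H e = of_int m / 2 ^ N" using H_shift[of 0 m] by (simp add: e_def H_G_funpow)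
      moreover have "(1/2::real) ^ N \<le> (1/2) ^ n" unfolding N_def by (intro power_decreasing) auto
      ultimately show ?thesis by linarith
    qed
    ultimately show ?thesis by linarith
  qed
  moreover have "(\<lambda>n. H u - (1/2) ^ n) \<longlonglongrightarrow> H u - 0"
    by (intro tendsto_intros LIMSEQ_realpow_zero) auto
  ultimately have "H u \<le> H (u - ?\<delta>)" using LIMSEQ_le_const2 by fastforce
  moreover have "H (u - ?\<delta>) \<le> H u" using \<open>u < v\<close> by (intro H_mono) auto
  ultimately show ?thesis by simp
qed

text \<open>
  A plateau could be enlarged to the left by the same positive length again and again, which contradicts
  that \<open>H\<close> stays close to the identity.
\<close>

lemma H_strict_mono: "strict_mono H"
proof (rule ccontr)
  assume "\<not> strict_mono H"
  then obtain u v where "u < v" "\<not> H u < H v" by (auto simp: strict_mono_def)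
  with H_mono[of u v] have eq: "H u = H v" by auto
  \<comment> \<open>at a dyadic value a plateau would be mapped onto an interval where \<open>H\<close> is an integer, but \<open>H\<close> takes
    integer values only at integers\<close>
  have nonint: "2 ^ n * H u \<noteq> of_int m" for n m
  proof
    assume "2 ^ n * H u = of_int m"
    then have "(F ^^ n) u = of_int m" "(F ^^ n) v = of_int m"
      using eq H_int[of "(F ^^ n) u" m] H_int[of "(F ^^ n) v" m] by (simp_all add: H_funpow)
    then show False using \<open>u < v\<close> G_funpow_F by (metis less_irrefl)
  qed
  define \<delta> where "\<delta> = (v - u) * (G (1/2))\<^sup>2"
  have "\<delta> > 0" using \<open>u < v\<close> G_half by (simp add: \<delta>_def)
  have plateau: "H (u - real k * \<delta>) = H u" for k
  proof (induction k)
    case (Suc k)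
    define w where "w = u - real k * \<delta>"
    have "w \<le> u" using \<open>\<delta> > 0\<close> by (simp add: w_def)
    have "H (w - (v - w) * (G (1/2))\<^sup>2) = H w"
      using Suc eq \<open>w \<le> u\<close> \<open>u < v\<close> nonint by (intro plateau_extends_left) (auto simp: w_def)
    moreover have "w - (v - w) * (G (1/2))\<^sup>2 \<le> w - \<delta>"
      using \<open>w \<le> u\<close> by (simp add: \<delta>_def mult_right_mono)
    ultimately have "H u \<le> H (w - \<delta>)" using H_mono Suc by (metis w_def)
    moreover have "H (w - \<delta>) \<le> H u" using \<open>w \<le> u\<close> \<open>\<delta> > 0\<close> by (intro H_mono) auto
    ultimately show ?case by (simp add: w_def algebra_simps)
  qed simp
  obtain k :: nat where "(u - H u + 1) / \<delta> < k" using reals_Archimedean2 by blast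
  then have "u - H u + 1 < real k * \<delta>" using \<open>\<delta> > 0\<close> by (simp add: divide_less_eq)
  then show False using H_bounded[of "u - real k * \<delta>"] plateau[of k] by linarith
qed

end

section \<open>Rare visits away from the fixed point\<close>

lemma contracting_embedding_cases:
  assumes "contracting_embedding \<Phi>"
  shows "(\<forall>x\<in>{0..1}. \<forall>y\<in>{0..1}. x < y \<longrightarrow> \<Phi> x < \<Phi> y) \<or>
    (\<forall>x\<in>{0..1}. \<forall>y\<in>{0..1}. x < y \<longrightarrow> \<Phi> y < \<Phi> x)"
  using assms unfolding contracting_embedding_def monotone_on_def by blast

text \<open>
  The interval \<open>{q..1/2}\<close> keeps, under every inverse branch, at least a fixed share of the image of
  \<open>{a..1/2}\<close>, because the middle gap \<open>{a..q}\<close> cannot grow relative to its neighbours \<open>{0..a}\<close> and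
  \<open>{q..1/2}\<close>. This replaces independence in the probabilistic argument.
\<close>

lemma contracting_embedding_fraction:
  assumes \<Phi>: "contracting_embedding \<Phi>" and a: "0 < a" "a < q" "q < 1/2"
  shows "\<bar>\<Phi> q - \<Phi> a\<bar> \<le> \<bar>\<Phi> (1/2) - \<Phi> a\<bar> / (1 + 4 * a * (1/2 - q))"
proof -
  define c where "c = a * (1/2 - q)"
  have c: "c > 0" using a by (simp add: c_def)
  have *: "4 * c * m \<le> r"
    if "l > 0" "m > 0" "r > 0" "(l + m + r) * m * c \<le> (1/2) * (q - a) * (l * r)" for l m r :: real
  proof -
    have "l * m * c \<le> (l + m + r) * m * c" using that c by (intro mult_right_mono) auto
    also have "\<dots> \<le> (1/2) * (q - a) * (l * r)" by fact
    also have "\<dots> \<le> (1/2) * (1/2) * (l * r)" using that a by (intro mult_mono) auto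
    finally have "l * (4 * c * m) \<le> l * r" by (simp add: mult_ac)
    then show ?thesis using that by simp
  qed
  define l m r where "l = \<Phi> a - \<Phi> 0" and "m = \<Phi> q - \<Phi> a" and "r = \<Phi> (1/2) - \<Phi> q"
  have cr: "(l + m + r) * m * c \<le> (1/2) * (q - a) * (l * r)"
    using cross_ratio_contractingD[of "{0..1}" \<Phi> 0 a q "1/2"] \<Phi> a
    by (simp add: contracting_embedding_def c_def l_def m_def r_def mult_ac)
  have "l > 0 \<and> m > 0 \<and> r > 0 \<or> l < 0 \<and> m < 0 \<and> r < 0"
    using contracting_embedding_cases[OF \<Phi>] a unfolding l_def m_def r_def by fastforce
  then have "4 * c * \<bar>m\<bar> \<le> \<bar>r\<bar> \<and> \<bar>m + r\<bar> = \<bar>m\<bar> + \<bar>r\<bar>"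
  proof
    assume "l > 0 \<and> m > 0 \<and> r > 0"
    then show ?thesis using *[of l m r] cr by auto
  next
    assume "l < 0 \<and> m < 0 \<and> r < 0"
    then show ?thesis using *[of "-l" "-m" "-r"] cr by (auto simp: algebra_simps)
  qed
  then have "\<bar>m\<bar> * (1 + 4 * c) \<le> \<bar>m + r\<bar>" by (simp add: algebra_simps)
  then show ?thesis using c
    by (simp add: pos_le_divide_eq m_def r_def c_def mult.assoc)
qed

lemma sum_abs_diff_telescope:
  fixes p :: "nat \<Rightarrow> real"
  assumes "(\<forall>k. p k \<le> p (Suc k)) \<or> (\<forall>k. p (Suc k) \<le> p k)"
  shows "(\<Sum>k<n. \<bar>p k - p (Suc k)\<bar>) = \<bar>p 0 - p n\<bar>"
  using assms
proof
  assume "\<forall>k. p k \<le> p (Suc k)"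
  then have "(\<Sum>k<n. \<bar>p k - p (Suc k)\<bar>) = p n - p 0 \<and> p 0 \<le> p n"
    by (induction n) (auto intro: order_trans)
  then show ?thesis by auto
next
  assume "\<forall>k. p (Suc k) \<le> p k"
  then have "(\<Sum>k<n. \<bar>p k - p (Suc k)\<bar>) = p 0 - p n \<and> p n \<le> p 0"
    by (induction n) (auto intro: order_trans)
  then show ?thesis by auto
qed

text \<open>
  The terms decay like \<open>exp (- c \<epsilon> sqrt n)\<close>.
\<close>

lemma summable_heavy_tail_bound:
  fixes c \<epsilon> :: real
  assumes "c > 0" "\<epsilon> > 0"
  shows "summable (\<lambda>n. (1 / (1 + c / sqrt (real n))) powr (\<epsilon> * real n - 1))"
proof (rule summable_comparison_test_bigo)
  show "summable (\<lambda>n. norm (1 / real n ^ 2))"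
    using inverse_power_summable[of 2, where 'a = real] by (simp add: inverse_eq_divide)
  show "(\<lambda>n. (1 / (1 + c / sqrt (real n))) powr (\<epsilon> * real n - 1)) \<in> O(\<lambda>n. 1 / real n ^ 2)"
    using assms by real_asymp
qed

context flat_lift
begin

text \<open>
  With this choice \<open>F a = 1/2\<close>, so the first return to \<open>{a..1/2}\<close> maps each of its branches onto all of
  \<open>{a..1/2}\<close>.
\<close>

definition a :: real where "a = G (1/2)"

text \<open>
  The action of the circle map on the distance to the fixed point; it is well defined because \<open>F\<close> is odd.
\<close>

definition tent :: "real \<Rightarrow> real" where "tent t = (if t \<le> a then F t else 1 - F t)"

definition visits :: "nat \<Rightarrow> real \<Rightarrow> nat"
  where "visits n t = (\<Sum>i<n. if a \<le> (tent ^^ i) t then 1 else 0)"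

text \<open>
  Points of \<open>{a..1/2}\<close> that return at least \<open>j\<close> more times with every return taking at most \<open>M\<close> steps. The
  map \<open>\<lambda>y. G (1 - (G ^^ k) y)\<close> is the inverse branch for a return after \<open>k + 1\<close> steps. Building the set from
  inverse branches makes it compact and makes the measure estimate an induction over branches.
\<close>

primrec quick :: "nat \<Rightarrow> nat \<Rightarrow> real set" where
  "quick M 0 = {a..1/2}"
| "quick M (Suc j) = (\<Union>k<M. (\<lambda>y. G (1 - (G ^^ k) y)) ` quick M j)"

lemma a_bounds: "0 < a" "a < 1/2" using G_half by (simp_all add: a_def)

lemma F_a [simp]: "F a = 1/2" by (simp add: a_def)

lemma tent_bounds: "0 \<le> t \<Longrightarrow> t \<le> 1/2 \<Longrightarrow> 0 \<le> tent t \<and> tent t \<le> 1/2"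
  using F_le_iff[of t a] F_le_iff[of a t] F_le_iff[of 0 t] F_le_iff[of t "1/2"]
  by (auto simp: tent_def simp del: F_le_iff)

lemma tent_funpow_bounds: "0 \<le> t \<Longrightarrow> t \<le> 1/2 \<Longrightarrow> 0 \<le> (tent ^^ i) t \<and> (tent ^^ i) t \<le> 1/2"
  using tent_bounds by (induction i) auto

lemma G_tent: "t \<le> a \<Longrightarrow> G (tent t) = t" and G_1_minus_tent: "a \<le> t \<Longrightarrow> G (1 - tent t) = t"
  by (auto simp: tent_def) (auto simp: a_def)

lemma visits_Suc: "visits (Suc n) t = (if a \<le> t then 1 else 0) + visits n (tent t)"
  unfolding visits_def by (subst sum.lessThan_Suc_shift) (simp add: funpow_swap1)

lemma first_visit:
  assumes "0 \<le> t" "t \<le> 1/2" "Suc j \<le> visits m t"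
  shows "\<exists>k<m. \<exists>y\<in>{a..1/2}. t = (G ^^ k) y \<and> Suc j \<le> visits (m - k) y"
  using assms
proof (induction m arbitrary: t)
  case (Suc m)
  show ?case
  proof (cases "a \<le> t")
    case True
    then show ?thesis using Suc.prems by (intro exI[of _ 0] conjI bexI[of _ t]) auto
  next
    case False
    then have "Suc j \<le> visits m (tent t)" using Suc.prems by (simp add: visits_Suc)
    then obtain k y where "k < m" "y \<in> {a..1/2}" "tent t = (G ^^ k) y" "Suc j \<le> visits (m - k) y"
      using Suc.IH[of "tent t"] tent_bounds[OF Suc.prems(1,2)] by blast
    moreover from this have "t = (G ^^ Suc k) y" using G_tent[of t] False by simp
    ultimately show ?thesis by (intro exI[of _ "Suc k"] conjI bexI[of _ y]) auto
  qed
qed (simp add: visits_def)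

text \<open>
  If there are more than \<open>j\<close> visits before time \<open>m\<close>, each of the first \<open>j\<close> returns takes fewer than \<open>m\<close>
  steps, simply because all of them fit into the time available.
\<close>

lemma many_visits_imp_quick:
  assumes "t \<in> {a..1/2}" "Suc j \<le> visits m t" "m \<le> M"
  shows "t \<in> quick M j"
  using assms
proof (induction j arbitrary: t m)
  case (Suc j)
  then obtain m' where m: "m = Suc m'" by (cases m) (auto simp: visits_def)
  have "Suc j \<le> visits m' (tent t)" using Suc.prems by (simp add: m visits_Suc)
  moreover have "0 \<le> tent t" "tent t \<le> 1/2" using tent_bounds[of t] Suc.prems a_bounds by auto
  ultimately obtain k y where k: "k < m'" "y \<in> {a..1/2}" "tent t = (G ^^ k) y" "Suc j \<le> visits (m' - k) y"
    using first_visit by blast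
  then have "y \<in> quick M j" using Suc.IH[of y "m' - k"] Suc.prems m by auto
  moreover have "t = G (1 - (G ^^ k) y)" using k(3) G_1_minus_tent[of t] Suc.prems by simp
  ultimately show ?case using k Suc.prems m by auto
qed simp

lemma G_unit: "0 \<le> y \<Longrightarrow> y \<le> 1 \<Longrightarrow> 0 \<le> G y \<and> G y \<le> 1"
  using G_bounds[of y] by auto

lemma G_funpow_bounds: "0 \<le> y \<Longrightarrow> y \<le> 1 \<Longrightarrow> 0 \<le> (G ^^ k) y \<and> (G ^^ k) y \<le> 1"
  using G_unit by (induction k) auto

lemma G_funpow_continuous: "continuous_on UNIV (G ^^ k)"
proof (induction k)
  case (Suc k)
  then show ?case using continuous_on_compose[of UNIV "G ^^ k" G] G_continuous
    by (auto intro: continuous_on_subset)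
qed (simp add: id_def)

lemma compact_quick: "compact (quick M j)"
proof (induction j)
  case (Suc j)
  have "continuous_on UNIV (\<lambda>y. G (1 - (G ^^ k) y))" for k
    by (intro continuous_on_compose2[OF G_continuous] continuous_intros G_funpow_continuous) auto
  then show ?case using Suc
    by (auto intro!: compact_UN compact_continuous_image intro: continuous_on_subset)
qed simp

lemma quick_subset: "quick M j \<subseteq> {0..1}"
proof (induction j)
  case (Suc j)
  show ?case
  proof clarsimp
    fix k y assume "y \<in> quick M j"
    then have "0 \<le> 1 - (G ^^ k) y \<and> 1 - (G ^^ k) y \<le> 1" using G_funpow_bounds[of y k] Suc by auto
    then show "0 \<le> G (1 - (G ^^ k) y) \<and> G (1 - (G ^^ k) y) \<le> 1" using G_unit by blast
  qed
qed (use a_bounds in auto)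

text \<open>
  Points of \<open>{a..1/2}\<close> beyond this one need more than \<open>M\<close> steps to return.
\<close>

definition slow_edge :: "nat \<Rightarrow> real" where "slow_edge M = G (1 - (G ^^ M) (1/2))"

lemma contracting_embedding_return_branch:
  assumes "contracting_embedding \<Phi>"
  shows "contracting_embedding (\<lambda>y. \<Phi> (G (1 - (G ^^ k) y)))"
proof (induction k)
  case 0
  then show ?case using contracting_embedding_compose_G(2)[OF assms] by simp
next
  case (Suc k)
  then show ?case using contracting_embedding_compose_G(1)[OF Suc] by (simp add: funpow_swap1)
qed

lemma exit_points_decreasing: "(G ^^ Suc k) (1/2) < (G ^^ k) (1/2)"
  by (induction k) (use G_half in auto)

lemma exit_points_bounds: "0 < (G ^^ k) (1/2) \<and> (G ^^ k) (1/2) \<le> 1/2"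
proof (induction k)
  case (Suc k)
  then show ?case using G_less_iff[of 0 "(G ^^ k) (1/2)"] exit_points_decreasing[of k] by auto
qed simp

lemma slow_edge_bounds: "M > 0 \<Longrightarrow> a < slow_edge M" "slow_edge M < 1/2"
proof -
  have "(G ^^ M) (1/2) < 1/2" if "M > 0"
    using that exit_points_decreasing[of "M - 1"] exit_points_bounds[of "M - 1"] by auto
  then show "M > 0 \<Longrightarrow> a < slow_edge M" by (simp add: a_def slow_edge_def)
  show "slow_edge M < 1/2"
    using G_less_iff[of "1 - (G ^^ M) (1/2)" 1] exit_points_bounds[of M] by (simp add: slow_edge_def)
qed

text \<open>
  Each return that is not slow costs the factor of \<open>contracting_embedding_fraction\<close>. The induction runs over
  all contracting embeddings at once: composing \<open>\<Phi>\<close> with a return branch gives another one, so the hypothesis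
  applies to each piece of \<open>quick M (Suc j)\<close>. The pieces are adjacent, whence their sizes add up to the
  image of the single interval between \<open>a\<close> and the slow edge.
\<close>

lemma measure_quick_image:
  assumes "contracting_embedding \<Phi>" and M: "M > 0"
  shows "measure lborel (\<Phi> ` quick M j)
    \<le> (1 / (1 + 4 * a * (1/2 - slow_edge M))) ^ j * \<bar>\<Phi> (1/2) - \<Phi> a\<bar>"
  using assms(1)
proof (induction j arbitrary: \<Phi>)
  case 0
  have "\<Phi> ` {a..1/2} \<subseteq> {min (\<Phi> a) (\<Phi> (1/2))..max (\<Phi> a) (\<Phi> (1/2))}"
  proof clarsimp
    fix t assume t: "a \<le> t" "t * 2 \<le> 1"
    have mem: "a \<in> {0..1}" "t \<in> {0..1}" "1/2 \<in> {0..1::real}" using t a_bounds by auto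
    show "min (\<Phi> a) (\<Phi> (1/2)) \<le> \<Phi> t \<and> \<Phi> t \<le> max (\<Phi> a) (\<Phi> (1/2))"
    proof (cases "t = a \<or> t = 1/2")
      case True
      then show ?thesis by (elim disjE; hypsubst; simp)
    next
      case False
      then have "a < t" "t < 1/2" using t by auto
      then show ?thesis using contracting_embedding_cases[OF 0] mem by (fastforce simp: min_def max_def)
    qed
  qed
  then have "measure lborel (\<Phi> ` {a..1/2}) \<le> measure lborel {min (\<Phi> a) (\<Phi> (1/2))..max (\<Phi> a) (\<Phi> (1/2))}"
    by (intro measure_mono_fmeasurable) (use 0 a_bounds in \<open>auto intro!: borel_compact compact_continuous_image
      intro: continuous_on_subset simp: contracting_embedding_def fmeasurable_def\<close>)
  also have "\<dots> = \<bar>\<Phi> (1/2) - \<Phi> a\<bar>" by (auto simp: min_def max_def)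
  finally show ?case by simp
next
  case (Suc j)
  let ?\<theta> = "1 / (1 + 4 * a * (1/2 - slow_edge M))"
  let ?\<Psi> = "\<lambda>k y. \<Phi> (G (1 - (G ^^ k) y))"
  let ?p = "\<lambda>k. \<Phi> (G (1 - (G ^^ k) (1/2)))"
  have \<theta>: "?\<theta> ^ j \<ge> 0" using a_bounds slow_edge_bounds[of M] by simp
  have cont: "continuous_on {0..1} (?\<Psi> k)" for k
    using contracting_embedding_return_branch[OF Suc.prems] by (simp add: contracting_embedding_def)
  have "\<Phi> ` quick M (Suc j) = (\<Union>k<M. ?\<Psi> k ` quick M j)" by auto
  also have "measure lborel \<dots> \<le> (\<Sum>k<M. measure lborel (?\<Psi> k ` quick M j))"
    by (intro measure_UNION_le)
       (auto intro!: borel_compact compact_continuous_image compact_quick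
         continuous_on_subset[OF cont quick_subset])
  also have "\<dots> \<le> (\<Sum>k<M. ?\<theta> ^ j * \<bar>?p k - ?p (Suc k)\<bar>)"
    using Suc.IH[OF contracting_embedding_return_branch[OF Suc.prems]]
    by (intro sum_mono) (simp add: a_def funpow_swap1)
  also have "\<dots> = ?\<theta> ^ j * \<bar>?p 0 - ?p M\<bar>"
  proof -
    have "?p k < ?p (Suc k)" if up: "\<forall>x\<in>{0..1}. \<forall>y\<in>{0..1}. x < y \<longrightarrow> \<Phi> x < \<Phi> y" for k
    proof -
      have "G (1 - (G ^^ i) (1/2)) \<in> {0..1}" for i
        using exit_points_bounds[of i] G_bounds[of "1 - (G ^^ i) (1/2)"] by auto
      then show ?thesis using up exit_points_decreasing[of k] by (simp del: funpow.simps)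
    qed
    moreover have "?p (Suc k) < ?p k" if down: "\<forall>x\<in>{0..1}. \<forall>y\<in>{0..1}. x < y \<longrightarrow> \<Phi> y < \<Phi> x" for k
    proof -
      have "G (1 - (G ^^ i) (1/2)) \<in> {0..1}" for i
        using exit_points_bounds[of i] G_bounds[of "1 - (G ^^ i) (1/2)"] by auto
      then show ?thesis using down exit_points_decreasing[of k] by (simp del: funpow.simps)
    qed
    ultimately have "(\<Sum>k<M. \<bar>?p k - ?p (Suc k)\<bar>) = \<bar>?p 0 - ?p M\<bar>"
      using contracting_embedding_cases[OF Suc.prems] by (intro sum_abs_diff_telescope) (meson less_imp_le)
    then show ?thesis by (simp add: sum_distrib_left[symmetric])
  qed
  also have "\<bar>?p 0 - ?p M\<bar> = \<bar>\<Phi> (slow_edge M) - \<Phi> a\<bar>" by (simp add: a_def slow_edge_def abs_minus_commute)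
  also have "?\<theta> ^ j * \<dots> \<le> ?\<theta> ^ j * (\<bar>\<Phi> (1/2) - \<Phi> a\<bar> / (1 + 4 * a * (1/2 - slow_edge M)))"
    using contracting_embedding_fraction[OF Suc.prems a_bounds(1) slow_edge_bounds(1)[OF M] slow_edge_bounds(2)]
    by (intro mult_left_mono \<theta>)
  finally show ?case by simp
qed

lemma \<Lambda>_ge: "2 \<le> \<Lambda>" using le_linear[of "1/2"] by simp

lemma G_ge: "0 \<le> y \<Longrightarrow> y \<le> 1 \<Longrightarrow> y / \<Lambda> \<le> G y"
  using le_linear[of "G y"] G_bounds[of y] \<Lambda>_ge by (simp add: divide_le_eq mult.commute)

lemma exit_points_lower: "1 / (2 * \<Lambda> ^ k) \<le> (G ^^ k) (1/2)"
proof (induction k)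
  case (Suc k)
  have "1 / (2 * \<Lambda> ^ Suc k) = 1 / (2 * \<Lambda> ^ k) / \<Lambda>" by simp
  also have "\<dots> \<le> (G ^^ k) (1/2) / \<Lambda>" using Suc \<Lambda>_ge by (intro divide_right_mono) auto
  also have "\<dots> \<le> G ((G ^^ k) (1/2))" using exit_points_bounds[of k] by (intro G_ge) auto
  finally show ?case by simp
qed simp

text \<open>
  A point at distance \<open>\<delta>\<close> from \<open>1/2\<close> is sent to within \<open>K exp (- \<kappa> / \<delta>\<^sup>2)\<close> of the fixed point, from which the
  distance grows at most by the factor \<open>\<Lambda>\<close> per step. So the return takes at least a constant times
  \<open>1 / \<delta>\<^sup>2\<close> steps: returns longer than \<open>M\<close> have probability of order at least \<open>1 / sqrt M\<close>, and the mean return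
  time is infinite.
\<close>

lemma heavy_tail: "\<exists>c>0. \<forall>M>0. c / sqrt (real M) \<le> 4 * a * (1/2 - slow_edge M)"
proof -
  define E where "E = ln \<Lambda> + \<bar>ln (2 * K)\<bar>"
  have ln\<Lambda>: "ln \<Lambda> > 0" using \<Lambda>_ge by simp
  then have E: "E > 0" by (simp add: E_def)
  have "sqrt (\<kappa> / E) / sqrt (real M) \<le> 1/2 - slow_edge M" if M: "M > 0" for M
  proof -
    define \<delta> where "\<delta> = 1/2 - slow_edge M"
    have \<delta>: "0 < \<delta>" "\<delta> \<le> 1/2"
      using slow_edge_bounds(1)[OF M] slow_edge_bounds(2)[of M] a_bounds by (auto simp: \<delta>_def)
    have "1 / (2 * \<Lambda> ^ M) \<le> (G ^^ M) (1/2)" by (rule exit_points_lower)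
    also have "\<dots> = 1 - F (1/2 - \<delta>)" by (simp add: \<delta>_def slow_edge_def)
    also have "\<dots> \<le> K * exp (- \<kappa> / \<delta>\<^sup>2)" using flat_at_half[OF \<delta>] .
    finally have le: "1 / (2 * \<Lambda> ^ M) \<le> K * exp (- \<kappa> / \<delta>\<^sup>2)" .
    moreover have "0 < 1 / (2 * \<Lambda> ^ M)" using \<Lambda>_ge by simp
    ultimately have "0 < K * exp (- \<kappa> / \<delta>\<^sup>2)" by linarith
    then have K: "K > 0" by (simp add: zero_less_mult_iff)
    have "exp (\<kappa> / \<delta>\<^sup>2) \<le> 2 * K * \<Lambda> ^ M"
      using le \<Lambda>_ge by (simp add: exp_minus field_simps)
    then have "\<kappa> / \<delta>\<^sup>2 \<le> ln (2 * K * \<Lambda> ^ M)"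
      using K \<Lambda>_ge by (subst ln_ge_iff) auto
    also have "\<dots> = ln (2 * K) + real M * ln \<Lambda>"
      using K \<Lambda>_ge by (simp add: ln_mult ln_realpow)
    also have "\<dots> \<le> real M * \<bar>ln (2 * K)\<bar> + real M * ln \<Lambda>"
      using M mult_right_mono[of 1 "real M" "\<bar>ln (2 * K)\<bar>"] by auto
    also have "\<dots> = real M * E" by (simp add: E_def distrib_left)
    finally have "\<kappa> / (E * real M) \<le> \<delta>\<^sup>2" using \<delta> E M by (simp add: field_simps)
    then have "sqrt (\<kappa> / (E * real M)) \<le> \<delta>" using \<delta> by (intro real_le_lsqrt) auto
    then show ?thesis by (simp add: \<delta>_def real_sqrt_divide real_sqrt_mult)
  qed
  then have "4 * a * sqrt (\<kappa> / E) / sqrt (real M) \<le> 4 * a * (1/2 - slow_edge M)" if "M > 0" for M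
    using that a_bounds mult_left_mono[of "sqrt (\<kappa> / E) / sqrt (real M)" "1/2 - slow_edge M" "4 * a"] by simp
  moreover have "4 * a * sqrt (\<kappa> / E) > 0" using a_bounds E \<kappa>_pos by simp
  ultimately show ?thesis by blast
qed

text \<open>
  More than \<open>\<epsilon> n\<close> visits before time \<open>n\<close> mean that about \<open>\<epsilon> n\<close> consecutive returns are each shorter than
  \<open>n\<close>. The measure of this event is at most of the order \<open>(1 - c / sqrt n) ^ (\<epsilon> n)\<close>, which is summable, and the
  Borel--Cantelli lemma applies.
\<close>

lemma AE_visits_sublinear:
  assumes "\<epsilon> > 0"
  shows "AE t in lborel. t \<in> {a..1/2} \<longrightarrow> (\<forall>\<^sub>F n in sequentially. real (visits n t) \<le> \<epsilon> * real n)"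
proof -
  obtain c where c: "c > 0" "\<And>M. M > 0 \<Longrightarrow> c / sqrt (real M) \<le> 4 * a * (1/2 - slow_edge M)"
    using heavy_tail by blast
  define J where "J n = nat \<lfloor>\<epsilon> * real n\<rfloor>" for n
  define A where "A n = quick n (J n)" for n
  have meas: "measure lborel (A n) \<le> (1 / (1 + c / sqrt (real n))) powr (\<epsilon> * real n - 1)"
    if n: "n > 0" for n
  proof -
    let ?\<theta> = "1 / (1 + 4 * a * (1/2 - slow_edge n))" and ?u = "1 / (1 + c / sqrt (real n))"
    have \<theta>: "0 \<le> ?\<theta>" "?\<theta> \<le> ?u" "0 < ?u" "?u \<le> 1"
      using c n a_bounds slow_edge_bounds(2)[of n] by (auto simp: frac_le add_pos_nonneg)
    have J: "\<epsilon> * real n - 1 \<le> real (J n)" unfolding J_def by linarith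
    have "contracting_embedding (\<lambda>y. 0 + y)" by (rule contracting_embedding_translation)
    then have "measure lborel (A n) \<le> ?\<theta> ^ J n * \<bar>1/2 - a\<bar>"
      using measure_quick_image[of "\<lambda>y. y" n "J n"] n by (simp add: A_def)
    also have "\<dots> \<le> ?u ^ J n * 1"
      using \<theta> a_bounds by (intro mult_mono power_mono) auto
    also have "\<dots> = ?u powr real (J n)" using \<theta> by (simp add: powr_realpow)
    also have "\<dots> \<le> ?u powr (\<epsilon> * real n - 1)"
      using \<theta> J by (intro powr_mono') auto
    finally show ?thesis .
  qed
  have "AE t in lborel. eventually (\<lambda>n. t \<in> space lborel - A n) sequentially"
  proof (rule borel_cantelli_AE1)
    show "A n \<in> sets lborel" for n using borel_compact[OF compact_quick] by (simp add: A_def)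
    show "emeasure lborel (A n) < \<infinity>" for n
      using emeasure_compact_finite[OF compact_quick] by (simp add: A_def)
    show "summable (\<lambda>n. measure lborel (A n))"
    proof (rule summable_comparison_test_ev[OF _ summable_heavy_tail_bound[OF c(1) assms]])
      show "\<forall>\<^sub>F n in sequentially. norm (measure lborel (A n))
          \<le> (1 / (1 + c / sqrt (real n))) powr (\<epsilon> * real n - 1)"
        using eventually_gt_at_top[of 0] by eventually_elim (use meas in simp)
    qed
  qed
  then show ?thesis
  proof eventually_elim
    case (elim t)
    show ?case
    proof
      assume t: "t \<in> {a..1/2}"
      show "\<forall>\<^sub>F n in sequentially. real (visits n t) \<le> \<epsilon> * real n"
        using elim
      proof eventually_elim
        case (elim n)
        then have "\<not> Suc (J n) \<le> visits n t" using many_visits_imp_quick[OF t, of "J n" n n] by (auto simp: A_def)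
        then have "real (visits n t) \<le> real (J n)" by simp
        also have "\<dots> \<le> \<epsilon> * real n" using assms unfolding J_def by simp
        finally show ?case .
      qed
    qed
  qed
qed

text \<open>
  Away from visits the tent orbit at least doubles, so \<open>s \<le> tent s - s\<close>. The sum telescopes, with an error
  of at most one for each visit.
\<close>

lemma orbit_sum_le_visits:
  assumes "0 \<le> t" "t \<le> 1/2"
  shows "(\<Sum>i<n. (tent ^^ i) t) \<le> real (visits n t) + (tent ^^ n) t - t"
  using assms
proof (induction n arbitrary: t)
  case (Suc n)
  have "t \<le> (if a \<le> t then 1 else 0) + tent t - t"
    using ge_double[of t] tent_bounds[OF Suc.prems] Suc.prems by (auto simp: tent_def)
  moreover have "(\<Sum>i<n. (tent ^^ i) (tent t)) \<le> real (visits n (tent t)) + (tent ^^ n) (tent t) - tent t"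
    using tent_bounds[OF Suc.prems] by (intro Suc.IH) auto
  ultimately show ?case
    by (subst sum.lessThan_Suc_shift) (simp add: visits_Suc funpow_swap1 split: if_splits)
qed (simp add: visits_def)

theorem AE_orbit_average_tendsto_0:
  "AE t in lborel. t \<in> {a..1/2} \<longrightarrow> (\<lambda>n. (\<Sum>i<n. (tent ^^ i) t) / real n) \<longlonglongrightarrow> 0"
proof -
  have "AE t in lborel. \<forall>q::nat. t \<in> {a..1/2} \<longrightarrow>
      (\<forall>\<^sub>F n in sequentially. real (visits n t) \<le> 1 / real (Suc q) * real n)"
    unfolding AE_all_countable by (intro allI AE_visits_sublinear) simp
  then show ?thesis
  proof eventually_elim
    case (elim t)
    show ?case
    proof
      assume t: "t \<in> {a..1/2}"
      then have t0: "0 \<le> t" "t \<le> 1/2" using a_bounds by auto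
      show "(\<lambda>n. (\<Sum>i<n. (tent ^^ i) t) / real n) \<longlonglongrightarrow> 0"
      proof (rule LIMSEQ_I)
        fix r :: real assume "r > 0"
        then obtain q where q: "1 / real (Suc q) < r / 2" using nat_approx_posE[of "r / 2"] by auto
        obtain N1 where N1: "\<And>n. n \<ge> N1 \<Longrightarrow> real (visits n t) \<le> 1 / real (Suc q) * real n"
          using elim t unfolding eventually_sequentially by blast
        obtain N2 :: nat where N2: "1 / r < real N2" using reals_Archimedean2 by blast
        show "\<exists>N. \<forall>n\<ge>N. norm ((\<Sum>i<n. (tent ^^ i) t) / real n - 0) < r"
        proof (intro exI allI impI)
          fix n assume n: "max (Suc N1) (Suc N2) \<le> n"
          have n0: "real n > 0" using n by auto
          have "1 / r < real n" using N2 n by auto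
          then have nr: "1 < r * real n" using \<open>r > 0\<close> by (simp add: divide_less_eq mult.commute)
          have "0 \<le> (\<Sum>i<n. (tent ^^ i) t)" using tent_funpow_bounds[OF t0] by (intro sum_nonneg) auto
          moreover have "(\<Sum>i<n. (tent ^^ i) t) < r * real n"
          proof -
            have "(\<Sum>i<n. (tent ^^ i) t) \<le> real (visits n t) + 1/2"
              using orbit_sum_le_visits[OF t0, of n] tent_funpow_bounds[OF t0, of n] t0 by linarith
            also have "\<dots> \<le> 1 / real (Suc q) * real n + 1/2" using N1[of n] n by auto
            also have "\<dots> < r / 2 * real n + r * real n / 2"
              using mult_strict_right_mono[OF q n0] nr by linarith
            finally show ?thesis by simp
          qed
          ultimately show "norm ((\<Sum>i<n. (tent ^^ i) t) / real n - 0) < r"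
            using n0 by (simp add: divide_less_eq)
        qed
      qed
    qed
  qed
qed

end

section \<open>The map on the circle\<close>

lemma to_circle_rep [simp]: "to_circle (circle_rep x) = x"
  by (rule Quotient_abs_rep[OF Quotient_circle])

lemma to_circle_plus_int [simp]: "to_circle (t + of_int m) = to_circle t"
  by (simp add: to_circle_eq_iff)

lemma continuous_on_circleI:
  fixes h :: "circle \<Rightarrow> 'a::topological_space"
  assumes "continuous_on UNIV (\<lambda>t. h (to_circle t))"
  shows "continuous_on UNIV h"
  using assms unfolding continuous_on_open_vimage[OF open_UNIV] open_circle_def
  by (simp add: vimage_def)

lemma open_image_to_circle:
  assumes "open U" shows "open (to_circle ` U)"
proof -
  have "to_circle -` (to_circle ` U) = (\<Union>m::int. (\<lambda>t. of_int m + t) ` U)"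
  proof (intro set_eqI iffI)
    fix t assume "t \<in> to_circle -` (to_circle ` U)"
    then obtain u where "u \<in> U" "t - u \<in> \<int>" by (auto simp: to_circle_eq_iff)
    then show "t \<in> (\<Union>m::int. (\<lambda>t. of_int m + t) ` U)"
      by (auto elim!: Ints_cases intro!: image_eqI[of _ _ u] simp: algebra_simps)
  qed (auto simp: to_circle_eq_iff image_iff intro!: bexI)
  then show ?thesis unfolding open_circle_def
    by (simp add: open_UN open_translation assms)
qed

definition circle_map :: "(real \<Rightarrow> real) \<Rightarrow> circle \<Rightarrow> circle"
  where "circle_map L x = to_circle (L (circle_rep x))"

lemma circle_map_to_circle:
  assumes "\<And>t. L (t + 1) = L t + of_int d"
  shows "circle_map L (to_circle t) = to_circle (L t)"
proof -
  obtain m :: int where "circle_rep (to_circle t) = t + of_int m"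
    using to_circle_eq_iff[of "circle_rep (to_circle t)" t] by (auto elim!: Ints_cases simp: algebra_simps)
  then have "L (circle_rep (to_circle t)) = L t + of_int (m * d)"
    using degree_lift_shift[of L "of_int d" t m, OF assms] by simp
  then show ?thesis unfolding circle_map_def by (metis to_circle_plus_int)
qed

lemma continuous_circle_map:
  assumes "\<And>t. L (t + 1) = L t + of_int d" "continuous_on UNIV L"
  shows "continuous_on UNIV (circle_map L)"
  by (rule continuous_on_circleI)
     (use assms in \<open>auto simp: circle_map_to_circle intro: continuous_on_compose2[OF continuous_to_circle]\<close>)

lemma homeomorphism_circle_map:
  assumes cont: "continuous_on UNIV L" and mono: "strict_mono L" and shift: "\<And>t. L (t + 1) = L t + 1"
  shows "homeomorphism UNIV UNIV (circle_map L) (circle_map (inv L))"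
proof -
  have bij: "bij L" and cont': "continuous_on UNIV (inv L)"
    using degree_lift_homeomorphism[OF cont mono shift] by auto
  have inv: "L (inv L y) = y" "inv L (L t) = t" for y t
    using bij by (auto simp: bij_def surj_f_inv_f)
  have shift': "inv L (t + 1) = inv L t + 1" for t
    using shift[of "inv L t"] inv by metis
  have map: "circle_map L (to_circle t) = to_circle (L t)"
      "circle_map (inv L) (to_circle t) = to_circle (inv L t)" for t
    using circle_map_to_circle[of L 1] circle_map_to_circle[of "inv L" 1] shift shift' by auto
  have "circle_map (inv L) (circle_map L x) = x" "circle_map L (circle_map (inv L) x) = x" for x
    using to_circle_surj[of x] by (auto simp: map inv)
  moreover have "continuous_on UNIV (circle_map L)" "continuous_on UNIV (circle_map (inv L))"
    using continuous_circle_map[of L 1] continuous_circle_map[of "inv L" 1] shift shift' cont cont' by auto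
  ultimately show ?thesis
    by (intro homeomorphismI) auto
qed

lemma local_homeomorphism_circle_map:
  assumes cont: "continuous_on UNIV L" and mono: "strict_mono L"
    and shift: "\<And>t. L (t + 1) = L t + of_int d" and d: "d > 0"
  shows "local_homeomorphism (circle_map L)"
  unfolding local_homeomorphism_def
proof
  fix x
  obtain t where t: "x = to_circle t" using to_circle_surj by blast
  have map: "circle_map L (to_circle t) = to_circle (L t)" for t
    by (rule circle_map_to_circle[where d = d]) (rule shift)
  have bij: "bij L" and inv_cont: "continuous_on UNIV (inv L)"
    using degree_lift_homeomorphism[OF cont mono shift] d by auto
  have open_L: "open (L ` V)" if "open V" for V
  proof -
    have "L ` V = inv L -` V" using bij by (simp add: bij_vimage_eq_inv_image bij_imp_bij_inv inv_inv_eq)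
    then show ?thesis using open_vimage[OF that inv_cont] by simp
  qed
  have open_map: "open (circle_map L ` W)" if "open W" for W
  proof -
    have "W = to_circle ` (to_circle -` W)" using to_circle_surj by auto
    then have "circle_map L ` W = to_circle ` (L ` (to_circle -` W))"
      by (metis (no_types, lifting) image_cong image_image map)
    then show ?thesis using that open_L open_image_to_circle by (simp add: open_circle_def)
  qed
  have "isCont L t" using cont by (simp add: continuous_on_eq_continuous_at)
  \<comment> \<open>on an arc whose image under the lift is shorter than \<open>1\<close> the circle map is injective\<close>
  then obtain r where r: "r > 0" "\<And>s. \<bar>s - t\<bar> < r \<Longrightarrow> \<bar>L s - L t\<bar> < 1/2"
    unfolding continuous_at_eps_delta dist_real_def by (metis half_gt_zero_iff zero_less_one)
  define I where "I = {t - r<..<t + r}"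
  define U where "U = to_circle ` I"
  have "open U" unfolding U_def I_def by (intro open_image_to_circle) auto
  have "x \<in> U" using r by (auto simp: U_def I_def t)
  have inj: "inj_on (circle_map L) U"
  proof (rule inj_onI)
    fix y z assume yz: "y \<in> U" "z \<in> U" and eq: "circle_map L y = circle_map L z"
    then obtain u v where uv: "y = to_circle u" "z = to_circle v" "u \<in> I" "v \<in> I" by (auto simp: U_def)
    have "L u - L v \<in> \<int>" using eq by (simp add: uv map to_circle_eq_iff)
    moreover have "\<bar>L u - L v\<bar> < 1" using r(2)[of u] r(2)[of v] uv unfolding I_def
      by (auto simp only: greaterThanLessThan_iff abs_less_iff) linarith+
    ultimately have "L u = L v" using Ints_nonzero_abs_less1 by force
    then show "y = z" using mono by (simp add: uv strict_mono_eq)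
  qed
  have "\<exists>g. homeomorphism U (circle_map L ` U) (circle_map L) g"
  proof (rule homeomorphism_injective_open_map[OF _ refl inj])
    show "continuous_on U (circle_map L)"
      using continuous_circle_map[of L d, OF shift cont] continuous_on_subset by blast
    show "openin (top_of_set (circle_map L ` U)) (circle_map L ` W)" if W: "openin (top_of_set U) W" for W
    proof -
      have "open W" using openin_open_trans[OF W \<open>open U\<close>] .
      then show ?thesis by (intro open_subset image_mono openin_imp_subset[OF W] open_map)
    qed
  qed blast
  then show "\<exists>U. open U \<and> x \<in> U \<and> open (circle_map L ` U) \<and>
      (\<exists>g. homeomorphism U (circle_map L ` U) (circle_map L) g)"
    using \<open>open U\<close> \<open>x \<in> U\<close> open_map by blast
qed

text \<open>
  A continuous function whose only zero is the fixed point. For convergence to a Dirac measure at that zero,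
  it is the only test function that matters.
\<close>

lift_definition gap :: "circle \<Rightarrow> real" is "\<lambda>t. 1 - cos (2 * pi * t)"
proof -
  fix s t :: real assume "s - t \<in> \<int>"
  then obtain m where "s = t + of_int m" by (auto elim!: Ints_cases simp: algebra_simps)
  then show "1 - cos (2 * pi * s) = 1 - cos (2 * pi * t)"
    by (simp add: distrib_left cos_add cos_int_2pin sin_int_2pin)
qed

lemma gap_to_circle: "gap (to_circle t) = 1 - cos (2 * pi * t)"
  by (rule gap.abs_eq)

lemma continuous_gap: "continuous_on UNIV gap"
  by (rule continuous_on_circleI) (auto simp: gap_to_circle intro!: continuous_intros)

lemma gap_nonneg: "gap x \<ge> 0"
  using to_circle_surj[of x] by (auto simp: gap_to_circle)

lemma to_circle_surj_centered: "\<exists>t. \<bar>t\<bar> \<le> 1/2 \<and> x = to_circle t"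
proof -
  obtain t where t: "x = to_circle t" using to_circle_surj by blast
  have "\<bar>t - of_int \<lfloor>t + 1/2\<rfloor>\<bar> \<le> 1/2" by linarith
  moreover have "to_circle (t - of_int \<lfloor>t + 1/2\<rfloor>) = x"
    using to_circle_plus_int[of t "- \<lfloor>t + 1/2\<rfloor>"] by (simp add: t)
  ultimately show ?thesis by blast
qed

text \<open>
  Continuity handles points near the fixed point; elsewhere \<open>gap\<close> is bounded below and \<open>g\<close> is bounded.
\<close>

lemma continuous_le_eps_plus_gap:
  fixes g :: "circle \<Rightarrow> real"
  assumes g: "continuous_on UNIV g" and "\<epsilon> > 0"
  shows "\<exists>C\<ge>0. \<forall>x. \<bar>g x - g (to_circle 0)\<bar> \<le> \<epsilon> + C * gap x"
proof -
  define u where "u t = g (to_circle t) - g (to_circle 0)" for t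
  have cont: "continuous_on UNIV u"
    unfolding u_def by (intro continuous_intros continuous_on_compose2[OF g continuous_to_circle]) auto
  then have "isCont u 0" by (simp add: continuous_on_eq_continuous_at)
  then obtain r where r: "r > 0" "\<And>t. \<bar>t\<bar> < r \<Longrightarrow> \<bar>u t\<bar> < \<epsilon>"
    using \<open>\<epsilon> > 0\<close> unfolding continuous_at_eps_delta dist_real_def u_def by auto
  define \<delta> where "\<delta> = min r (1/2)"
  have \<delta>: "0 < \<delta>" "\<delta> \<le> 1/2" "\<delta> \<le> r" using r by (auto simp: \<delta>_def)
  have "compact (u ` {-1/2..1/2})" by (intro compact_continuous_image continuous_on_subset[OF cont]) auto
  then obtain B where B: "\<And>t. \<bar>t\<bar> \<le> 1/2 \<Longrightarrow> \<bar>u t\<bar> \<le> B"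
    using compact_imp_bounded[THEN bounded_iff[THEN iffD1]] by (fastforce simp: abs_le_iff)
  have "B \<ge> 0" using B[of 0] by auto
  define \<eta> where "\<eta> = 1 - cos (2 * pi * \<delta>)"
  have \<eta>: "\<eta> > 0" using cos_monotone_0_pi[of 0 "2 * pi * \<delta>"] \<delta> mult_left_mono[of \<delta> "1/2" pi]
    by (simp add: \<eta>_def)
  show ?thesis
  proof (intro exI[of _ "B / \<eta>"] conjI allI)
    show "0 \<le> B / \<eta>" using \<open>B \<ge> 0\<close> \<eta> by simp
    fix x
    obtain t where t: "\<bar>t\<bar> \<le> 1/2" "x = to_circle t" using to_circle_surj_centered by blast
    show "\<bar>g x - g (to_circle 0)\<bar> \<le> \<epsilon> + B / \<eta> * gap x"
    proof (cases "\<bar>t\<bar> < r")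
      case True
      then have "\<bar>u t\<bar> \<le> \<epsilon>" using r(2) by force
      moreover have "0 \<le> B / \<eta> * gap x" using \<open>B \<ge> 0\<close> \<eta> gap_nonneg by simp
      ultimately show ?thesis by (simp add: u_def t)
    next
      case False
      then have "\<delta> \<le> \<bar>t\<bar>" using \<delta> by simp
      have "cos (2 * pi * \<bar>t\<bar>) \<le> cos (2 * pi * \<delta>)"
        using \<delta> \<open>\<delta> \<le> \<bar>t\<bar>\<close> mult_left_mono[OF t(1), of pi] by (intro cos_monotone_0_pi_le) auto
      moreover have "cos (2 * pi * \<bar>t\<bar>) = cos (2 * pi * t)" by (cases "t \<ge> 0") auto
      ultimately have "\<eta> \<le> gap x" by (simp add: \<eta>_def t gap_to_circle)
      then have "B * 1 \<le> B * (gap x / \<eta>)" using \<open>B \<ge> 0\<close> \<eta> by (intro mult_left_mono) auto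
      then show ?thesis using B[OF t(1)] \<open>\<epsilon> > 0\<close> by (simp add: u_def t)
    qed
  qed
qed

lemma basin_return_iff:
  "x \<in> basin f (return borel (to_circle 0)) \<longleftrightarrow>
    (\<lambda>n. (\<Sum>i<n. gap ((f ^^ i) x)) / real n) \<longlonglongrightarrow> 0"
proof
  have lim: "integral\<^sup>L (return borel (to_circle 0)) g = g (to_circle 0)"
    if "continuous_on UNIV g" for g :: "circle \<Rightarrow> real"
    using borel_measurable_continuous_onI[OF that] by (intro integral_return) auto
  {
    assume "x \<in> basin f (return borel (to_circle 0))"
    then have "(\<lambda>n. integral\<^sup>L (empirical_measure f x n) gap)
        \<longlonglongrightarrow> integral\<^sup>L (return borel (to_circle 0)) gap"
      using continuous_gap unfolding basin_def circle_weak_conv_def by blast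
    then show "(\<lambda>n. (\<Sum>i<n. gap ((f ^^ i) x)) / real n) \<longlonglongrightarrow> 0"
      unfolding integral_empirical_measure[OF continuous_gap] lim[OF continuous_gap] gap_to_circle
      by simp
  }
  assume conv: "(\<lambda>n. (\<Sum>i<n. gap ((f ^^ i) x)) / real n) \<longlonglongrightarrow> 0"
  show "x \<in> basin f (return borel (to_circle 0))"
    unfolding basin_def circle_weak_conv_def mem_Collect_eq
  proof (intro allI impI)
    fix g :: "circle \<Rightarrow> real" assume g: "continuous_on UNIV g"
    let ?A = "\<lambda>h n. (\<Sum>i<n. h ((f ^^ i) x)) / real n" and ?p = "to_circle 0"
    have "(\<lambda>n. ?A g n) \<longlonglongrightarrow> g ?p"
    proof (rule tendstoI)
      fix \<epsilon> :: real assume "\<epsilon> > 0"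
      then obtain C where C: "C \<ge> 0" "\<And>x. \<bar>g x - g ?p\<bar> \<le> \<epsilon> / 2 + C * gap x"
        using continuous_le_eps_plus_gap[OF g, of "\<epsilon> / 2"] by auto
      have "(\<lambda>n. C * ?A gap n) \<longlonglongrightarrow> C * 0" by (intro tendsto_intros conv)
      then have "\<forall>\<^sub>F n in sequentially. C * ?A gap n < \<epsilon> / 2"
        using \<open>\<epsilon> > 0\<close> by (intro order_tendstoD) auto
      then show "\<forall>\<^sub>F n in sequentially. dist (?A g n) (g ?p) < \<epsilon>"
        using eventually_gt_at_top[of 0]
      proof eventually_elim
        case (elim n)
        have "?A g n - g ?p = (\<Sum>i<n. g ((f ^^ i) x) - g ?p) / real n"
          using elim by (simp add: sum_subtractf diff_divide_distrib)
        also have "\<bar>\<dots>\<bar> \<le> (\<Sum>i<n. \<epsilon> / 2 + C * gap ((f ^^ i) x)) / real n"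
          unfolding abs_divide
          by (intro frac_le order_trans[OF sum_abs] sum_mono C sum_nonneg)
             (use elim C gap_nonneg \<open>\<epsilon> > 0\<close> in auto)
        also have "\<dots> = \<epsilon> / 2 + C * ?A gap n"
          using elim by (simp add: sum.distrib sum_distrib_left[symmetric] add_divide_distrib)
        finally show ?case using elim(1) unfolding dist_real_def by linarith
      qed
    qed
    then show "(\<lambda>n. integral\<^sup>L (empirical_measure f x n) g) \<longlonglongrightarrow> integral\<^sup>L (return borel ?p) g"
      unfolding integral_empirical_measure[OF g] lim[OF g] .
  qed
qed

text \<open>
  Countable quantifiers only, as needed for measurability of the set of convergence.
\<close>

lemma tendsto_0_iff_reciprocal:
  fixes X :: "nat \<Rightarrow> real"
  shows "X \<longlonglongrightarrow> 0 \<longleftrightarrow> (\<forall>k. \<exists>N. \<forall>n\<ge>N. \<bar>X n\<bar> < 1 / real (Suc k))"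
proof
  assume "X \<longlonglongrightarrow> 0"
  then show "\<forall>k. \<exists>N. \<forall>n\<ge>N. \<bar>X n\<bar> < 1 / real (Suc k)"
    using LIMSEQ_D[of X 0 "1 / real (Suc k)" for k] by simp
next
  assume *: "\<forall>k. \<exists>N. \<forall>n\<ge>N. \<bar>X n\<bar> < 1 / real (Suc k)"
  show "X \<longlonglongrightarrow> 0"
  proof (rule LIMSEQ_I)
    fix r :: real assume "r > 0"
    then obtain k where k: "1 / real (Suc k) < r" using nat_approx_posE by auto
    obtain N where "\<forall>n\<ge>N. \<bar>X n\<bar> < 1 / real (Suc k)" using * by blast
    then show "\<exists>N. \<forall>n\<ge>N. norm (X n - 0) < r"
      using k by (intro exI[of _ N]) force
  qed
qed

text \<open>
  Measurability matters here: \<open>measure\<close> vanishes by convention on sets that are not measurable.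
\<close>

lemma basin_return_borel:
  assumes f: "continuous_on UNIV f"
  shows "basin f (return borel (to_circle 0)) \<in> sets borel"
proof -
  have "continuous_on UNIV (f ^^ i)" for i
  proof (induction i)
    case (Suc i)
    then show ?case using continuous_on_compose[of UNIV "f ^^ i" f] f by (auto intro: continuous_on_subset)
  qed (simp add: id_def)
  then have "(\<lambda>x. gap ((f ^^ i) x)) \<in> borel_measurable borel" for i
    by (intro borel_measurable_continuous_onI continuous_on_compose2[OF continuous_gap]) auto
  note [measurable] = this
  have "basin f (return borel (to_circle 0)) =
      {x. \<forall>k. \<exists>N. \<forall>n\<ge>N. \<bar>(\<Sum>i<n. gap ((f ^^ i) x)) / real n\<bar> < 1 / real (Suc k)}"
    unfolding set_eq_iff basin_return_iff tendsto_0_iff_reciprocal mem_Collect_eq by simp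
  also have "\<dots> = {x \<in> space borel. \<forall>k. \<exists>N. \<forall>n\<ge>N. \<bar>(\<Sum>i<n. gap ((f ^^ i) x)) / real n\<bar> < 1 / real (Suc k)}"
    by simp
  also have "\<dots> \<in> sets borel" by measurable
  finally show ?thesis .
qed

context flat_lift
begin

abbreviation f :: "circle \<Rightarrow> circle" where "f \<equiv> circle_map F"

lemma f_to_circle: "f (to_circle t) = to_circle (F t)"
  using circle_map_to_circle[of F 2] shift by simp

lemma f_continuous: "continuous_on UNIV f"
  using continuous_circle_map[of F 2] shift continuous by simp

lemma f_in_doubling_class: "f \<in> doubling_class"
proof -
  have "local_homeomorphism f"
    using local_homeomorphism_circle_map[OF continuous strict_mono, of 2] shift by simp
  moreover have "top_conjugate f doubling"
    unfolding top_conjugate_def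
  proof (intro exI conjI)
    have H1: "H (t + 1) = H t + 1" for t using H_shift[of t 1] by simp
    then have H_map: "circle_map H (to_circle t) = to_circle (H t)" for t
      using circle_map_to_circle[of H 1] by simp
    show "homeomorphism UNIV UNIV (circle_map H) (circle_map (inv H))"
      by (rule homeomorphism_circle_map[OF H_continuous H_strict_mono H1])
    show "circle_map H \<circ> f = doubling \<circ> circle_map H"
    proof
      fix x
      obtain t where "x = to_circle t" using to_circle_surj by blast
      then show "(circle_map H \<circ> f) x = (doubling \<circ> circle_map H) x"
        by (simp add: f_to_circle H_map H_F doubling.abs_eq)
    qed
  qed
  ultimately show ?thesis by (simp add: doubling_class_def)
qed

lemma f_lift: "is_lift F f"
  by (simp add: is_lift_def continuous f_to_circle)

lemma f_fixed: "f (to_circle 0) = to_circle 0"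
  by (simp add: f_to_circle)

lemma f_fixed_unique:
  assumes "f q = q" shows "q = to_circle 0"
proof -
  obtain t where t: "\<bar>t\<bar> \<le> 1/2" "q = to_circle t" using to_circle_surj_centered by blast
  have no_fixed: "s = 0" if "0 \<le> s" "s \<le> 1/2" "F s - s \<in> \<int>" for s
  proof (rule ccontr)
    assume "s \<noteq> 0"
    have "0 < F s - s" "F s - s < 1"
      using ge_double[of s] that \<open>s \<noteq> 0\<close> F_le_iff[of s "1/2"] by (auto simp del: F_le_iff)
    then show False using Ints_nonzero_abs_less1[OF that(3)] by auto
  qed
  have Z: "F t - t \<in> \<int>" using assms by (simp add: t f_to_circle to_circle_eq_iff)
  have "t = 0"
  proof (cases "t \<ge> 0")
    case True
    then show ?thesis using no_fixed[of t] t Z by auto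
  next
    case False
    then show ?thesis using no_fixed[of "- t"] t Ints_minus[OF Z] by (simp add: odd)
  qed
  then show ?thesis by (simp add: t)
qed

lemma f_orbit_tent:
  assumes "0 \<le> t" "t \<le> 1/2"
  shows "(f ^^ i) (to_circle t) \<in> {to_circle ((tent ^^ i) t), to_circle (- (tent ^^ i) t)}"
proof (induction i)
  case (Suc i)
  have step: "to_circle (F s) \<in> {to_circle (tent s), to_circle (- tent s)} \<and>
      to_circle (- F s) \<in> {to_circle (tent s), to_circle (- tent s)}" for s
  proof (cases "s \<le> a")
    case False
    then have "F s = - tent s + of_int 1" "- F s = tent s + of_int (- 1)" by (auto simp: tent_def)
    then show ?thesis by (metis insertI1 insertI2 to_circle_plus_int)
  qed (simp add: tent_def)
  have "(f ^^ i) (to_circle t) = to_circle ((tent ^^ i) t) \<or>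
      (f ^^ i) (to_circle t) = to_circle (- (tent ^^ i) t)"
    using Suc by blast
  then have "f ((f ^^ i) (to_circle t)) = to_circle (F ((tent ^^ i) t)) \<or>
      f ((f ^^ i) (to_circle t)) = to_circle (- F ((tent ^^ i) t))"
    using f_to_circle odd by metis
  then show ?case using step[of "(tent ^^ i) t"] unfolding funpow.simps o_apply by metis
qed simp

lemma gap_orbit_le:
  assumes "0 \<le> t" "t \<le> 1/2"
  shows "gap ((f ^^ i) (to_circle t)) \<le> 2 * pi * (tent ^^ i) t"
proof -
  define s where "s = (tent ^^ i) t"
  have s: "0 \<le> s" "s \<le> 1/2" using tent_funpow_bounds[OF assms] by (auto simp: s_def)
  have sin: "0 \<le> sin (pi * s)" "sin (pi * s) \<le> pi * s"
    using s mult_left_mono[OF s(2), of pi] by (auto intro!: sin_ge_zero sin_x_le_x)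
  have "gap ((f ^^ i) (to_circle t)) = 1 - cos (2 * pi * s)"
    using f_orbit_tent[OF assms, of i] by (auto simp: gap_to_circle s_def)
  also have "\<dots> = 2 * (sin (pi * s) * sin (pi * s))"
    using cos_double_sin[of "pi * s"] by (simp add: power2_eq_square mult.assoc)
  also have "\<dots> \<le> 2 * (1 * (pi * s))"
    using sin by (intro mult_left_mono mult_mono) auto
  finally show ?thesis by (simp add: s_def)
qed

lemma AE_in_basin:
  "AE t in lborel. t \<in> {a..1/2} \<longrightarrow> to_circle t \<in> basin f (return borel (to_circle 0))"
  using AE_orbit_average_tendsto_0
proof eventually_elim
  case (elim t)
  show ?case
  proof
    assume t: "t \<in> {a..1/2}"
    then have t0: "0 \<le> t" "t \<le> 1/2" using a_bounds by auto
    have "(\<lambda>n. 2 * pi * ((\<Sum>i<n. (tent ^^ i) t) / real n)) \<longlonglongrightarrow> 2 * pi * 0"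
      by (intro tendsto_intros) (use elim t in blast)
    then have lim: "(\<lambda>n. 2 * pi * ((\<Sum>i<n. (tent ^^ i) t) / real n)) \<longlonglongrightarrow> 0" by simp
    have le: "(\<Sum>i<n. gap ((f ^^ i) (to_circle t))) / real n \<le> 2 * pi * ((\<Sum>i<n. (tent ^^ i) t) / real n)" for n
      using gap_orbit_le[OF t0] by (simp add: sum_distrib_left sum_mono divide_right_mono)
    have "0 \<le> (\<Sum>i<n. gap ((f ^^ i) (to_circle t))) / real n" for n
      by (simp add: sum_nonneg gap_nonneg)
    then show "to_circle t \<in> basin f (return borel (to_circle 0))"
      unfolding basin_return_iff
      by (intro tendsto_sandwich[OF _ _ tendsto_const lim] always_eventually allI le)
  qed
qed

lemma measure_basin_pos: "measure circle_lebesgue (basin f (return borel (to_circle 0))) > 0"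
proof -
  let ?B = "basin f (return borel (to_circle 0))"
  have B: "?B \<in> sets borel" by (rule basin_return_borel[OF f_continuous])
  have meas: "to_circle \<in> borel_measurable (restrict_space lborel {0..<1})"
    using borel_measurable_continuous_onI[OF continuous_to_circle] by (intro measurable_restrict_space1) simp
  have Y: "to_circle -` ?B \<in> sets borel"
    using measurable_sets[OF borel_measurable_continuous_onI[OF continuous_to_circle] B] by simp
  have "emeasure circle_lebesgue ?B
      = emeasure (restrict_space lborel {0..<1}) (to_circle -` ?B \<inter> {0..<1})"
    unfolding circle_lebesgue_def using B meas
    by (subst emeasure_distr) (auto simp: space_restrict_space)
  also have "\<dots> = emeasure lborel (to_circle -` ?B \<inter> {0..<1})"
    by (intro emeasure_restrict_space) auto
  also have "\<dots> \<ge> emeasure lborel {a..1/2}"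
  proof (rule emeasure_mono_AE)
    show "AE t in lborel. t \<in> {a..1/2} \<longrightarrow> t \<in> to_circle -` ?B \<inter> {0..<1}"
      using AE_in_basin by eventually_elim (use a_bounds in auto)
    show "to_circle -` ?B \<inter> {0..<1} \<in> sets lborel" using Y by simp
  qed
  finally have "emeasure lborel {a..1/2} \<le> emeasure circle_lebesgue ?B" .
  moreover have "emeasure lborel {a..1/2} > 0" using a_bounds by simp
  ultimately have "emeasure circle_lebesgue ?B > 0" by (rule order.strict_trans2[rotated])
  moreover have "finite_measure circle_lebesgue"
    using prob_space_circle_lebesgue by (rule prob_space.finite_measure)
  ultimately show ?thesis
    by (simp add: finite_measure.emeasure_eq_measure)
qed

end

theorem theorem1p3:
  shows "\<exists>f. f \<in> doubling_class \<and> circle_smooth f \<and>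
    (\<exists>p. f p = p \<and> (\<forall>q. f q = q \<longrightarrow> q = p) \<and> sisyphus_attractor f p)"
proof -
  obtain F \<Lambda> K \<kappa> \<rho> where lift: "flat_lift F \<Lambda> K \<kappa>" and \<rho>: "flat_trig_poly \<rho>"
    and deriv: "\<And>t. (F has_real_derivative \<rho> t) (at t)" and "\<rho> 0 > 1"
    by (rule flat_lift_exists) (rule that)
  interpret flat_lift F \<Lambda> K \<kappa> by (rule lift)
  have smooth: "circle_smooth f"
    unfolding circle_smooth_def
    using f_lift antiderivative_flat_trig_poly_smooth[OF \<rho> deriv] by (intro exI[of _ F]) simp
  have sisyphus: "sisyphus_attractor f (to_circle 0)"
    unfolding sisyphus_attractor_def circle_deriv_eq[OF f_lift deriv]
    using f_fixed \<open>\<rho> 0 > 1\<close> measure_basin_pos by simp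
  show ?thesis
    by (intro exI[of _ f] exI[of _ "to_circle 0"] conjI allI impI
      f_in_doubling_class smooth f_fixed f_fixed_unique sisyphus)
qed

end
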